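(* Let $i,j$ be real numbers with $0<i,j<1$ and $i+j=1$, and set $\sigma=\min\{i,j\}$. Let $a,b\in\mathbb{R}$ with $a\neq 0$, and let $\mathsf{L}_{a,b}=\{(x,y)\in\mathbb{R}^2: y=ax+b\}$. Suppose there exists $\epsilon>0$ such that $$\liminf_{q\to\infty} q^{\frac{1}{\sigma}-\epsilon}\max\{\|qa\|,\|qb\|\}>0.$$ Then for every $\boldsymbol\theta=(\gamma,\delta)\in\mathbb{R}^2$, the set $\mathrm{Bad}_{\boldsymbol\theta}(i,j)\cap\mathsf{L}_{a,b}$ is a winning subset of $\mathsf{L}_{a,b}$. Moreover, if $a\in\mathbb{Q}$, the same conclusion holds when the displayed condition is assumed with $\epsilon=0$.
   Context: For $t\in\mathbb{R}$, $\|t\|$ denotes the distance from $t$ to the nearest integer. For $\boldsymbol\theta=(\gamma,\delta)\in\mathbb{R}^2$, $\mathrm{Bad}_{\boldsymbol\theta}(i,j)$ is the set of $(x,y)\in\mathbb{R}^2$ for which there is a constant $c(x,y)>0$ with $\max\{\|qx-\gamma\|^{1/i},\|qy-\delta\|^{1/j}\}>c(x,y)\,q^{-1}$ for all $q\in\mathbb{N}$. Schmidt's $(\alpha,\beta)$-game on a space $M$ (here the line $M=\mathsf{L}_{a,b}$ with the metric induced from $\mathbb{R}^2$, played with closed segments/balls of $M$): for $0<\alpha,\beta<1$, player B chooses a closed ball $B_0$; then A chooses a closed ball $A_0\subset B_0$ with $\rho(A_0)=\alpha\rho(B_0)$; then B chooses a closed ball $B_1\subset A_0$ with $\rho(B_1)=\beta\rho(A_0)$,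 and so on alternately, producing nested balls $B_0\supset A_0\supset B_1\supset\cdots$, where $\rho$ denotes diameter. A set $X\subset M$ is $(\alpha,\beta)$-winning if A can play so that the single point $\bigcap_n B_n$ lies in $X$ regardless of how B plays; $\alpha$-winning if $(\alpha,\beta)$-winning for all $\beta\in(0,1)$; winning if $\alpha$-winning for some $\alpha\in(0,1)$. *)

theory Defs
  imports "HOL-Analysis.Analysis"
begin

definition dist_int :: "real \<Rightarrow> real" where
  "dist_int t = infdist t \<int>"

definition Bad :: "real \<times> real \<Rightarrow> real \<Rightarrow> real \<Rightarrow> (real \<times> real) set" where
  "Bad \<theta> i j = {(x, y). \<exists>c>0. \<forall>q::nat. q \<ge> 1 \<longrightarrow>
     max (dist_int (real q * x - fst \<theta>) powr (1 / i))
         (dist_int (real q * y - snd \<theta>) powr (1 / j)) > c / real q}"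

definition plane_line :: "real \<Rightarrow> real \<Rightarrow> (real \<times> real) set" where
  "plane_line a b = {(x, y). y = a * x + b}"

definition closed_balls :: "'a::metric_space set \<Rightarrow> 'a set set" where
  "closed_balls M = {M \<inter> cball x r | x r. x \<in> M \<and> r > 0}"

text \<open>A strategy for player A maps the list \<open>[B 0, \<dots>, B n]\<close> of the moves made so far by
  player B to the ball \<open>A n\<close>. (The earlier moves of A are determined by the strategy.)\<close>

definition A_move :: "('a set list \<Rightarrow> 'a set) \<Rightarrow> (nat \<Rightarrow> 'a set) \<Rightarrow> nat \<Rightarrow> 'a set" where
  "A_move s B n = s (map B [0..<Suc n])"

definition legal_B_upto ::
  "'a::metric_space set \<Rightarrow> real \<Rightarrow> ('a set list \<Rightarrow> 'a set) \<Rightarrow> (nat \<Rightarrow> 'a set) \<Rightarrow> nat \<Rightarrow> bool" where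
  "legal_B_upto M \<beta> s B n \<longleftrightarrow> B 0 \<in> closed_balls M \<and>
     (\<forall>k<n. B (Suc k) \<in> closed_balls M \<and> B (Suc k) \<subseteq> A_move s B k \<and>
            diameter (B (Suc k)) = \<beta> * diameter (A_move s B k))"

text \<open>Legality of the moves of A is required after every finite legal initial part of a play.
  Requiring it only along infinite plays would let A win by an illegal move that leaves B without
  an answer.\<close>

definition legal_strategy ::
  "'a::metric_space set \<Rightarrow> real \<Rightarrow> real \<Rightarrow> ('a set list \<Rightarrow> 'a set) \<Rightarrow> bool" where
  "legal_strategy M \<alpha> \<beta> s \<longleftrightarrow> (\<forall>B n. legal_B_upto M \<beta> s B n \<longrightarrow>
     A_move s B n \<in> closed_balls M \<and> A_move s B n \<subseteq> B n \<and>
     diameter (A_move s B n) = \<alpha> * diameter (B n))"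

definition ab_winning :: "'a::metric_space set \<Rightarrow> real \<Rightarrow> real \<Rightarrow> 'a set \<Rightarrow> bool" where
  "ab_winning M \<alpha> \<beta> X \<longleftrightarrow> (\<exists>s. legal_strategy M \<alpha> \<beta> s \<and>
     (\<forall>B. (\<forall>n. legal_B_upto M \<beta> s B n) \<longrightarrow> (\<exists>x\<in>X. (\<Inter>n. B n) = {x})))"

definition alpha_winning :: "'a::metric_space set \<Rightarrow> real \<Rightarrow> 'a set \<Rightarrow> bool" where
  "alpha_winning M \<alpha> X \<longleftrightarrow> (\<forall>\<beta>. 0 < \<beta> \<and> \<beta> < 1 \<longrightarrow> ab_winning M \<alpha> \<beta> X)"

definition winning :: "'a::metric_space set \<Rightarrow> 'a set \<Rightarrow> bool" where
  "winning M X \<longleftrightarrow> X \<subseteq> M \<and> (\<exists>\<alpha>. 0 < \<alpha> \<and> \<alpha> < 1 \<and> alpha_winning M \<alpha> X)"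

end

theory Submission
  imports Defs
begin

text \<open>
  By symmetry let \<open>j \<le> i\<close>, and parametrise the line by \<open>x\<close>. Every rational point
  \<open>(p/q, r/q)\<close> lies on a rational line \<open>A x + B y + C = 0\<close> with \<open>\<bar>A\<bar> \<le> q\<^sup>i\<close> and
  \<open>\<bar>B\<bar> \<le> q\<^sup>j\<close>. If it is dangerously close to \<open>(x, a x + b)\<close>, then \<open>x\<close> lies within
  about \<open>c / (q D)\<close> of the intersection of that line with \<open>y = a x + b\<close>, where
  \<open>D = \<bar>A + a B\<bar>\<close>; the Diophantine condition on \<open>(a, b)\<close> keeps \<open>D\<close> above
  \<open>q\<^bsup>\<epsilon>-1\<^esup>\<close>. Group the points by the size of \<open>q D\<close> and of \<open>T = q\<^sup>i / D\<close>. All points of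
  one group that threaten a suitable interval share the same line, so they are covered by one short
  interval. For bounded \<open>T\<close> this holds because an integer of modulus less than 1 vanishes. For large
  \<open>T\<close> it holds even in an interval longer by a power of \<open>T\<close>, since otherwise the
  intersection of two lines would be a rational point of much smaller height that was avoided earlier.
  Hence the dangerous intervals that have to be taken into account at one stage have geometrically
  decreasing relative lengths, and player A avoids all of them by always moving to the quarter of
  smaller potential. Once the homogeneous points are avoided, two inhomogeneous ones of comparable
  height cannot threaten the same short interval (consider their difference), so they are
  avoided in the same play.
\<close>

section \<open>A potential strategy on a line\<close>

text \<open>The ratio \<open>2/3\<close> exceeds the factor \<open>1/2\<close> gained in each move
  and still gives summable weights. The shift 7 makes the sets that enter at stage
  \<open>n + 1\<close> weigh at most \<open>3 * (2/3) ^ (n + 8)\<close>, which is less than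
  \<open>(2/3) ^ n / 6\<close>, the gap between \<open>(2/3) ^ n / 2\<close> and the next
  threshold.\<close>

definition potential :: "(nat \<Rightarrow> nat \<Rightarrow> real set) \<Rightarrow> nat \<Rightarrow> real set \<Rightarrow> real" where
  "potential E n K = (\<Sum>k\<le>n. \<Sum>m. (2/3) ^ (k + 7 + m) * of_bool (E k m \<inter> K \<noteq> {}))"

text \<open>Only the two outer quarters compete, because half a ball lies between them: a set of
  diameter at most \<open>h/4\<close> cannot meet both.\<close>

definition better_quarter :: "(nat \<Rightarrow> nat \<Rightarrow> real set) \<Rightarrow> nat \<Rightarrow> real \<Rightarrow> real \<Rightarrow> real set" where
  "better_quarter E n u h =
     (if potential E n {u..u + h/4} \<le> potential E n {u + 3*h/4..u + h}
      then {u..u + h/4} else {u + 3*h/4..u + h})"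

text \<open>The premise on the sets with \<open>k + 7 + m' \<le> n\<close> is what the strategy has
  achieved by stage \<open>n\<close>. It allows the spread of \<open>E n m\<close> to be bounded
  only inside balls that earlier dangers no longer meet.\<close>

definition isolating :: "real \<Rightarrow> real \<Rightarrow> real \<Rightarrow> (nat \<Rightarrow> nat \<Rightarrow> real set) \<Rightarrow> bool" where
  "isolating u l \<eta> E \<longleftrightarrow> (\<forall>n m v. {v..v + l * \<eta> ^ n} \<subseteq> {u..u + l} \<longrightarrow>
     (\<forall>k m'. k + 7 + m' \<le> n \<longrightarrow> E k m' \<inter> {v..v + l * \<eta> ^ n} = {}) \<longrightarrow>
     (\<forall>x \<in> E n m \<inter> {v..v + l * \<eta> ^ n}. \<forall>y \<in> E n m \<inter> {v..v + l * \<eta> ^ n}.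
        \<bar>x - y\<bar> \<le> l * \<eta> ^ (n + 7 + m)))"

lemma isolatingD:
  assumes "isolating u l \<eta> E" "{v..v + l * \<eta> ^ n} \<subseteq> {u..u + l}"
    and "\<And>k m'. k + 7 + m' \<le> n \<Longrightarrow> E k m' \<inter> {v..v + l * \<eta> ^ n} = {}"
    and "x \<in> E n m \<inter> {v..v + l * \<eta> ^ n}" "y \<in> E n m \<inter> {v..v + l * \<eta> ^ n}"
  shows "\<bar>x - y\<bar> \<le> l * \<eta> ^ (n + 7 + m)"
  using assms unfolding isolating_def by blast

section \<open>Weights and monotonicity of the potential\<close>

lemma sums_potential_geometric: "(\<lambda>m. (2/3::real) ^ (k + m)) sums (3 * (2/3) ^ k)"
  using sums_mult[OF geometric_sums[of "2/3::real"], of "(2/3)^k"]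
  by (simp add: power_add mult.commute)

lemma summable_potential: "summable (\<lambda>m. (2/3::real) ^ (k + m) * of_bool (P m))"
  by (rule summable_comparison_test'[OF sums_summable[OF sums_potential_geometric[of k]], of 0]) auto

lemma potential_ge:
  assumes "k \<le> n" "E k m \<inter> K \<noteq> {}"
  shows "(2/3) ^ (k + 7 + m) \<le> potential E n K"
proof -
  let ?f = "\<lambda>k m. (2/3::real) ^ (k + 7 + m) * of_bool (E k m \<inter> K \<noteq> {})"
  have "(2/3) ^ (k + 7 + m) = (\<Sum>l\<in>{m}. ?f k l)"
    using assms by simp
  also have "\<dots> \<le> (\<Sum>l. ?f k l)"
    by (rule sum_le_suminf) (auto intro: summable_potential)
  also have "\<dots> = (\<Sum>l\<in>{k}. \<Sum>m. ?f l m)" by simp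
  also have "\<dots> \<le> potential E n K"
    unfolding potential_def using assms(1)
    by (intro sum_mono2) (auto intro!: suminf_nonneg summable_potential)
  finally show ?thesis .
qed

text \<open>Each relevant \<open>E k m\<close> contributes to at most one summand on the left, and
  then also to the right-hand side.\<close>

lemma potential_split:
  assumes "K1 \<subseteq> K" "K2 \<subseteq> K"
    and "\<And>k m. k \<le> n \<Longrightarrow> E k m \<inter> K1 = {} \<or> E k m \<inter> K2 = {}"
  shows "potential E n K1 + potential E n K2 \<le> potential E n K"
  unfolding potential_def sum.distrib[symmetric]
proof (rule sum_mono)
  fix k assume "k \<in> {..n}"
  then have k: "k \<le> n" by simp
  show "(\<Sum>m. (2/3::real) ^ (k + 7 + m) * of_bool (E k m \<inter> K1 \<noteq> {})) +
        (\<Sum>m. (2/3) ^ (k + 7 + m) * of_bool (E k m \<inter> K2 \<noteq> {}))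
        \<le> (\<Sum>m. (2/3) ^ (k + 7 + m) * of_bool (E k m \<inter> K \<noteq> {}))"
    unfolding suminf_add[OF summable_potential summable_potential]
  proof (rule suminf_le)
    fix m
    show "(2/3::real) ^ (k + 7 + m) * of_bool (E k m \<inter> K1 \<noteq> {}) +
          (2/3) ^ (k + 7 + m) * of_bool (E k m \<inter> K2 \<noteq> {})
        \<le> (2/3) ^ (k + 7 + m) * of_bool (E k m \<inter> K \<noteq> {})"
      using assms(1,2) assms(3)[OF k, of m] by (auto simp: of_bool_def)
  qed (intro summable_add summable_potential)+
qed

lemma suminf_potential_le:
  "(\<Sum>m. (2/3::real) ^ (k + m) * of_bool (P m)) \<le> 3 * (2/3) ^ k"
proof -
  have "(\<Sum>m. (2/3::real) ^ (k + m) * of_bool (P m)) \<le> (\<Sum>m. (2/3::real) ^ (k + m))"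
    by (intro suminf_le summable_potential sums_summable[OF sums_potential_geometric]) auto
  then show ?thesis using sums_unique[OF sums_potential_geometric[of k]] by simp
qed

lemma potential_mono: "K \<subseteq> K' \<Longrightarrow> potential E n K \<le> potential E n K'"
  unfolding potential_def
  by (intro sum_mono suminf_le summable_potential) (auto simp: of_bool_def)

lemma potential_Suc_le: "potential E (Suc n) K \<le> potential E n K + 3 * (2/3) ^ (n + 8)"
  using suminf_potential_le[of "Suc n + 7" "\<lambda>m. E (Suc n) m \<inter> K \<noteq> {}"]
  by (simp add: potential_def add_ac)

lemma better_quarter_subset: "h > 0 \<Longrightarrow> better_quarter E n u h \<subseteq> {u..u + h}"
  by (auto simp: better_quarter_def)

text \<open>A dangerous set of stage \<open>k\<close> and class \<open>m\<close> is shorter than the balls of stage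
  \<open>k + 7 + m\<close>. Its weight, relative to the threshold \<open>(2/3) ^ n\<close>, reaches 1
  at exactly that stage, so a potential below the threshold means that the set has been left behind.
  The smaller quarter halves the potential, since a dangerous set that is still relevant cannot meet
  both quarters.\<close>

lemma potential_invariant:
  fixes u :: "nat \<Rightarrow> real" and l \<eta> :: real
  assumes l: "l > 0" and \<eta>: "0 < \<eta>" "\<eta> \<le> 1/4"
    and small: "isolating (u 0) l \<eta> E"
    and step: "\<And>n. {u (Suc n)..u (Suc n) + l * \<eta> ^ Suc n}
                     \<subseteq> better_quarter E n (u n) (l * \<eta> ^ n)"
  shows "potential E n {u n..u n + l * \<eta> ^ n} < (2/3) ^ n"
proof (induction n rule: less_induct)
  case (less n)
  let ?J = "\<lambda>n. {u n..u n + l * \<eta> ^ n}"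
  have nest1: "?J (Suc k) \<subseteq> ?J k" for k
    using step[of k] better_quarter_subset[of "l * \<eta> ^ k" E k "u k"] l \<eta> by fastforce
  have nest: "?J n' \<subseteq> ?J k" if "k \<le> n'" for k n'
    using lift_Suc_antimono_le[of ?J, OF _ that] nest1 by blast
  show ?case
  proof (cases n)
    case 0
    have "potential E 0 (?J 0) \<le> 3 * (2/3) ^ 7"
      using suminf_potential_le[of 7 "\<lambda>m. E 0 m \<inter> ?J 0 \<noteq> {}"] by (simp add: potential_def)
    also have "\<dots> < (1::real)" by (simp add: power_divide)
    finally show ?thesis using 0 by simp
  next
    case (Suc p)
    let ?h = "l * \<eta> ^ p"
    let ?L = "{u p..u p + ?h/4}" and ?R = "{u p + 3*?h/4..u p + ?h}"
    have h: "?h > 0" using l \<eta> by simp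
    \<comment> \<open>The weight of such a set alone is at least the threshold
      \<open>(2/3) ^ q\<close>, against the induction hypothesis.\<close>
    have dead: "E k m \<inter> ?J q = {}" if "q < n" "k + 7 + m \<le> q" for k m q
    proof (rule ccontr)
      assume "E k m \<inter> ?J q \<noteq> {}"
      then have "(2/3) ^ (k + 7 + m) \<le> potential E q (?J q)"
        using that by (intro potential_ge) auto
      moreover have "(2/3::real) ^ q \<le> (2/3) ^ (k + 7 + m)"
        using that by (intro power_decreasing) auto
      ultimately show False using less.IH[OF that(1)] by linarith
    qed
    have "E k m \<inter> ?L = {} \<or> E k m \<inter> ?R = {}" if "k \<le> p" for k m
    proof (rule ccontr)
      assume "\<not> ?thesis"
      then obtain x y where xy: "x \<in> E k m" "x \<in> ?L" "y \<in> E k m" "y \<in> ?R" by blast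
      then have J: "x \<in> ?J p" "y \<in> ?J p" using h by auto
      have late: "k + 7 + m > p"
        using dead[of p k m] xy J Suc by (metis disjoint_iff lessI not_le)
      \<comment> \<open>Isolation is used at stage \<open>k\<close>, where the set entered, in the
        larger ball \<open>?J k\<close> containing both points. The set is late, so its spread is at
        most \<open>?h / 4\<close>, but the quarters are \<open>?h / 2\<close> apart.\<close>
      have "\<bar>x - y\<bar> \<le> l * \<eta> ^ (k + 7 + m)"
        using nest[of 0 k] nest[of k p] that xy J Suc
        by (intro isolatingD[OF small, of "u k"]) (auto intro!: dead)
      also have "\<dots> \<le> l * \<eta> ^ Suc p"
        using l \<eta> late by (intro mult_left_mono power_decreasing) auto
      also have "\<dots> \<le> ?h / 4"
        using l \<eta> mult_left_mono[of \<eta> "1/4" ?h] h by (simp add: mult_ac)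
      finally show False using xy h by auto
    qed
    then have "potential E p ?L + potential E p ?R \<le> potential E p (?J p)"
      using h by (intro potential_split) auto
    then have half: "potential E p (better_quarter E p (u p) ?h) < (2/3) ^ p / 2"
      using less.IH[of p] Suc by (auto simp: better_quarter_def)
    have "potential E n (?J n) \<le> potential E p (?J n) + 3 * (2/3) ^ (p + 8)"
      using potential_Suc_le[of E p "?J n"] Suc by simp
    also have "\<dots> < (2/3) ^ p / 2 + 3 * (2/3) ^ (p + 8)"
      using potential_mono[OF step[of p], of E p] half Suc by simp
    also have "\<dots> \<le> (2/3) ^ n"
      using zero_less_power[of "2/3::real" p]
      unfolding Suc power_add power_Suc by (simp add: eval_nat_numeral)
    finally show ?thesis .
  qed
qed

lemma potential_avoids:
  fixes u :: "nat \<Rightarrow> real" and l \<eta> :: real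
  assumes "l > 0" and "0 < \<eta>" "\<eta> \<le> 1/4"
    and "isolating (u 0) l \<eta> E"
    and "\<And>n. {u (Suc n)..u (Suc n) + l * \<eta> ^ Suc n}
                     \<subseteq> better_quarter E n (u n) (l * \<eta> ^ n)"
    and x: "\<And>n. x \<in> {u n..u n + l * \<eta> ^ n}"
  shows "x \<notin> E k m"
proof
  assume "x \<in> E k m"
  then have "E k m \<inter> {u (k + 7 + m)..u (k + 7 + m) + l * \<eta> ^ (k + 7 + m)} \<noteq> {}"
    using x[of "k + 7 + m"] by blast
  then have "(2/3) ^ (k + 7 + m)
      \<le> potential E (k + 7 + m) {u (k + 7 + m)..u (k + 7 + m) + l * \<eta> ^ (k + 7 + m)}"
    by (intro potential_ge) auto
  with potential_invariant[of l \<eta> u E "k + 7 + m", OF assms(1-5)] show False by simp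
qed

section \<open>Closed balls of a line as images of intervals\<close>

lemma inj_affine_line:
  fixes w :: "'a::real_normed_vector"
  assumes "w \<noteq> 0"
  shows "inj (\<lambda>t::real. p + t *\<^sub>R w)"
  using assms by (auto simp: inj_def)

text \<open>The parametrisation multiplies distances by \<open>norm w\<close>, so balls correspond
  to intervals of half-length \<open>r / norm w\<close>.\<close>

lemma closed_balls_affine_line:
  fixes w :: "'a::real_normed_vector"
  assumes w: "w \<noteq> 0"
  shows "B \<in> closed_balls (range (\<lambda>t. p + t *\<^sub>R w)) \<longleftrightarrow>
           (\<exists>u h. h > 0 \<and> B = (\<lambda>t. p + t *\<^sub>R w) ` {u..u + h})"
proof -
  let ?\<phi> = "\<lambda>t. p + t *\<^sub>R w"
  have ball: "range ?\<phi> \<inter> cball (?\<phi> t) r = ?\<phi> ` {t - r / norm w..t + r / norm w}" for t r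
  proof -
    have "dist (?\<phi> t) (?\<phi> s) = \<bar>t - s\<bar> * norm w" for s
      by (simp add: dist_norm scaleR_diff_left[symmetric])
    then have "?\<phi> s \<in> cball (?\<phi> t) r \<longleftrightarrow> s \<in> {t - r / norm w..t + r / norm w}" for s
      using w pos_le_divide_eq[of "norm w" "\<bar>t - s\<bar>" r] by (auto simp: abs_le_iff)
    then show ?thesis by blast
  qed
  show ?thesis
  proof
    assume "B \<in> closed_balls (range ?\<phi>)"
    then obtain t r where "r > 0" "B = ?\<phi> ` {t - r / norm w..t + r / norm w}"
      unfolding closed_balls_def using ball by blast
    then show "\<exists>u h. h > 0 \<and> B = ?\<phi> ` {u..u + h}"
      using w by (intro exI[of _ "t - r / norm w"] exI[of _ "2 * r / norm w"]) auto
  next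
    assume "\<exists>u h. h > 0 \<and> B = ?\<phi> ` {u..u + h}"
    then obtain u h where h: "h > 0" "B = ?\<phi> ` {u..u + h}" by blast
    then have "B = range ?\<phi> \<inter> cball (?\<phi> (u + h/2)) (h/2 * norm w)"
      unfolding ball using w by (simp add: add.commute)
    moreover have "h/2 * norm w > 0" using h w by simp
    ultimately show "B \<in> closed_balls (range ?\<phi>)"
      unfolding closed_balls_def by blast
  qed
qed

lemma diameter_affine_interval:
  fixes w :: "'a::real_normed_vector"
  assumes "h \<ge> 0"
  shows "diameter ((\<lambda>t. p + t *\<^sub>R w) ` {u..u + h}) = norm w * h"
proof (rule antisym)
  let ?\<phi> = "\<lambda>t. p + t *\<^sub>R w"
  have d: "dist (?\<phi> s) (?\<phi> t) = norm w * \<bar>s - t\<bar>" for s t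
    by (simp add: dist_norm scaleR_diff_left[symmetric])
  show "diameter (?\<phi> ` {u..u + h}) \<le> norm w * h"
  proof (rule diameter_le)
    fix x y assume "x \<in> ?\<phi> ` {u..u + h}" "y \<in> ?\<phi> ` {u..u + h}"
    then obtain s t where st: "x = ?\<phi> s" "y = ?\<phi> t" "\<bar>s - t\<bar> \<le> h" by force
    show "norm (x - y) \<le> norm w * h"
      unfolding dist_norm[symmetric] st(1,2) d using st(3) by (intro mult_left_mono) auto
  qed (use assms in auto)
  have "compact (?\<phi> ` {u..u + h})"
    by (intro compact_continuous_image continuous_intros) auto
  then have "dist (?\<phi> u) (?\<phi> (u + h)) \<le> diameter (?\<phi> ` {u..u + h})"
    using assms by (intro diameter_bounded_bound compact_imp_bounded) auto
  then show "norm w * h \<le> diameter (?\<phi> ` {u..u + h})"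
    unfolding d using assms by simp
qed

lemma better_quarter_interval:
  obtains v where "better_quarter E n u h = {v..v + h/4}"
proof (cases "potential E n {u..u + h/4} \<le> potential E n {u + 3*h/4..u + h}")
  case True
  then show ?thesis by (intro that[of u]) (simp add: better_quarter_def)
next
  case False
  then show ?thesis by (intro that[of "u + 3*h/4"]) (simp add: better_quarter_def)
qed

text \<open>This reduces the game to the choice of a dangerous family on an interval. The family may
  depend on \<beta> and on the first ball, whereas the ratio \<open>1/4\<close> of player A does not
  depend on \<beta>.\<close>

lemma alpha_winning_quarterI:
  fixes w :: "'a::real_normed_vector"
  assumes w: "w \<noteq> 0"
    and avoid: "\<And>\<beta> u l. 0 < \<beta> \<Longrightarrow> \<beta> < 1 \<Longrightarrow> l > 0 \<Longrightarrow>
        \<exists>E. isolating u l (\<beta>/4) E \<and>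
            (\<forall>x\<in>{u..u + l}. (\<forall>k m. x \<notin> E k m) \<longrightarrow> p + x *\<^sub>R w \<in> X)"
  shows "alpha_winning (range (\<lambda>t. p + t *\<^sub>R w)) (1/4) X"
  unfolding alpha_winning_def
proof (intro allI impI)
  fix \<beta> :: real assume "0 < \<beta> \<and> \<beta> < 1"
  then have \<beta>: "0 < \<beta>" "\<beta> < 1" by auto
  define \<phi> where "\<phi> = (\<lambda>t. p + t *\<^sub>R w)"
  have inj: "inj \<phi>" unfolding \<phi>_def by (rule inj_affine_line[OF w])
  \<comment> \<open>A strategy is a function of the moves alone, so one family is fixed for each
    possible first interval.\<close>
  define EE where "EE u l = (SOME E. isolating u l (\<beta>/4) E \<and>
      (\<forall>x\<in>{u..u + l}. (\<forall>k m. x \<notin> E k m) \<longrightarrow> \<phi> x \<in> X))" for u l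
  have EE: "isolating u l (\<beta>/4) (EE u l) \<and>
      (\<forall>x\<in>{u..u + l}. (\<forall>k m. x \<notin> EE u l k m) \<longrightarrow> \<phi> x \<in> X)" if "l > 0" for u l
    using someI_ex[OF avoid[OF \<beta> that, of u]] unfolding EE_def \<phi>_def by blast
  \<comment> \<open>Moves are sets of points; \<open>lo\<close> and \<open>len\<close> recover the
    left end and the length of the parameter interval.\<close>
  define lo where "lo B = Inf (\<phi> -` B)" for B
  define len where "len B = Sup (\<phi> -` B) - Inf (\<phi> -` B)" for B
  have lo: "lo (\<phi> ` {u..u + h}) = u" and len: "len (\<phi> ` {u..u + h}) = h" if "h > 0" for u h
    using that by (simp_all add: lo_def len_def inj_vimage_image_eq[OF inj])
  \<comment> \<open>The list holds the moves of B from stage 0 on: its head determines the family,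
    its length minus 1 is the current stage, and its last entry is the ball to be divided.\<close>
  define s where "s Bs = \<phi> ` better_quarter (EE (lo (hd Bs)) (len (hd Bs)))
      (length Bs - 1) (lo (last Bs)) (len (last Bs))" for Bs
  have move: "A_move s B n =
      \<phi> ` better_quarter (EE (lo (B 0)) (len (B 0))) n (lo (B n)) (len (B n))" for B n
  proof -
    have "hd (map B [0..<Suc n]) = B 0" by (simp add: hd_map hd_upt del: upt_Suc)
    then show ?thesis by (simp add: A_move_def s_def)
  qed
  have balls: "B \<in> closed_balls (range \<phi>) \<longleftrightarrow> (\<exists>u h. h > 0 \<and> B = \<phi> ` {u..u + h})" for B
    unfolding \<phi>_def by (rule closed_balls_affine_line[OF w])
  have diam: "diameter (\<phi> ` {u..u + h}) = norm w * h" if "h > 0" for u h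
    using that unfolding \<phi>_def by (intro diameter_affine_interval) auto
  have repr: "len B > 0" "B = \<phi> ` {lo B..lo B + len B}" if "B \<in> closed_balls (range \<phi>)" for B
    using that lo len unfolding balls by auto
  have B_ball: "B n \<in> closed_balls (range \<phi>)" if "legal_B_upto (range \<phi>) \<beta> s B n" for B n
    using that unfolding legal_B_upto_def by (cases n) auto
  have A_ok: "A_move s B n \<in> closed_balls (range \<phi>) \<and> A_move s B n \<subseteq> B n \<and>
     diameter (A_move s B n) = 1/4 * diameter (B n) \<and> diameter (B n) = norm w * len (B n)"
    if "B n \<in> closed_balls (range \<phi>)" for B n
  proof -
    note r = repr[OF that]
    obtain v where v: "better_quarter (EE (lo (B 0)) (len (B 0))) n (lo (B n)) (len (B n))
        = {v..v + len (B n)/4}"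
      by (rule better_quarter_interval)
    have "A_move s B n \<subseteq> \<phi> ` {lo (B n)..lo (B n) + len (B n)}"
      unfolding move by (intro image_mono better_quarter_subset r)
    moreover have "diameter (B n) = norm w * len (B n)"
      using diam[OF r(1)] r(2) by metis
    moreover have "diameter (A_move s B n) = norm w * (len (B n)/4)"
      unfolding move v using r(1) by (intro diam) simp
    moreover have "A_move s B n \<in> closed_balls (range \<phi>)"
      unfolding move v balls using r(1) by (metis divide_pos_pos zero_less_numeral)
    ultimately show ?thesis using r(2) by simp
  qed
  have "\<exists>x\<in>X. (\<Inter>n. B n) = {x}" if legal: "\<And>n. legal_B_upto (range \<phi>) \<beta> s B n" for B
  proof -
    define u where "u n = lo (B n)" for n
    define l where "l = len (B 0)"
    define K where "K n = {u n..u n + l * (\<beta>/4) ^ n}" for n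
    have ball: "B n \<in> closed_balls (range \<phi>)" for n by (rule B_ball[OF legal])
    have l: "l > 0" unfolding l_def using repr(1)[OF ball] .
    have len_Suc: "len (B (Suc n)) = \<beta>/4 * len (B n)" for n
    proof -
      have "diameter (B (Suc n)) = \<beta> * diameter (A_move s B n)"
        using legal[of "Suc n"] unfolding legal_B_upto_def by blast
      then have "norm w * len (B (Suc n)) = norm w * (\<beta>/4 * len (B n))"
        using A_ok[of B n, OF ball] A_ok[of B "Suc n", OF ball] by (simp add: mult_ac)
      then show ?thesis using w by simp
    qed
    have lens: "len (B n) = l * (\<beta>/4) ^ n" for n
      by (induction n) (simp_all add: l_def len_Suc mult_ac)
    have BK: "B n = \<phi> ` K n" for n
      using repr(2)[OF ball, of n] unfolding K_def u_def lens .
    have step: "K (Suc n) \<subseteq> better_quarter (EE (u 0) l) n (u n) (l * (\<beta>/4) ^ n)" for n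
    proof -
      have "B (Suc n) \<subseteq> A_move s B n"
        using legal[of "Suc n"] unfolding legal_B_upto_def by blast
      then show ?thesis
        unfolding move BK[of "Suc n"] lens u_def[symmetric] by (simp add: inj_image_subset_iff[OF inj])
    qed
    have nest: "K (Suc n) \<subseteq> K n" for n
      unfolding K_def[of n] using l \<beta> by (intro order.trans[OF step better_quarter_subset]) simp
    have "\<exists>x. \<Inter>(range K) = {x}"
    proof (rule decreasing_closed_nest_sing)
      show "closed (K n)" for n by (simp add: K_def)
      show "K n \<noteq> {}" for n using l \<beta> by (simp add: K_def)
      show "K n \<subseteq> K m" if "m \<le> n" for m n
        using lift_Suc_antimono_le[of K, OF nest that] .
      show "\<exists>n. \<forall>x\<in>K n. \<forall>y\<in>K n. dist x y < e" if e: "e > 0" for e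
      proof -
        obtain n where n: "(\<beta>/4) ^ n < e / l"
          using real_arch_pow_inv[of "e / l" "\<beta>/4"] e l \<beta> by auto
        then have "l * (\<beta>/4) ^ n < e" using l by (simp add: field_simps)
        then show ?thesis unfolding K_def by (intro exI[of _ n]) (auto simp: dist_real_def)
      qed
    qed
    then obtain x where x: "\<Inter>(range K) = {x}" by blast
    then have xK: "x \<in> K n" for n by blast
    have "x \<notin> EE (u 0) l k m" for k m
      by (rule potential_avoids[of l "\<beta>/4" u "EE (u 0) l", OF l _ _ conjunct1[OF EE[OF l]]])
         (use \<beta> step xK in \<open>auto simp: K_def\<close>)
    moreover have "x \<in> {u 0..u 0 + l}" using xK[of 0] by (simp add: K_def)
    ultimately have "\<phi> x \<in> X" using EE[OF l, of "u 0"] by blast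
    moreover have "(\<Inter>n. B n) = {\<phi> x}"
      unfolding BK using x image_INT[OF inj, of UNIV K] by auto
    ultimately show ?thesis by blast
  qed
  then have "ab_winning (range \<phi>) (1/4) \<beta> X"
    unfolding ab_winning_def legal_strategy_def
    using A_ok B_ball by (intro exI[of _ s]) blast
  then show "ab_winning (range (\<lambda>t. p + t *\<^sub>R w)) (1/4) \<beta> X" unfolding \<phi>_def .
qed


section \<open>The Diophantine condition\<close>

lemma dist_int_le: "dist_int t \<le> \<bar>t - of_int m\<bar>"
  unfolding dist_int_def using infdist_le[of "of_int m" "\<int>" t] by (simp add: dist_real_def)

lemma dist_int_attained: obtains m :: int where "dist_int t = \<bar>t - of_int m\<bar>"
proof -
  obtain x where "x \<in> (\<int>::real set)" "infdist t \<int> = dist t x"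
    using infdist_attains_inf[of "\<int>::real set" t] Ints_0 closed_Ints by blast
  then show ?thesis by (metis Ints_cases dist_int_def dist_real_def that)
qed

lemma dist_int_nonneg: "dist_int t \<ge> 0"
  by (simp add: dist_int_def infdist_nonneg)

text \<open>The lower limit controls only large \<open>n\<close>. A zero at some
  \<open>n \<ge> 1\<close> would recur at all multiples of \<open>n\<close>, hence also at large
  arguments; so all values are positive and the finitely many small ones have a positive
  minimum.\<close>

lemma liminf_pos_imp_uniform_bound:
  fixes a b \<tau> :: real
  assumes "liminf (\<lambda>q::nat. ereal (real q powr \<tau> *
              max (dist_int (real q * a)) (dist_int (real q * b)))) > 0"
  obtains \<kappa> where "\<kappa> > 0"
    "\<And>n::nat. n \<ge> 1 \<Longrightarrow> \<kappa> \<le> real n powr \<tau> * max (dist_int (real n * a)) (dist_int (real n * b))"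
proof -
  define f where "f n = real n powr \<tau> * max (dist_int (real n * a)) (dist_int (real n * b))" for n :: nat
  obtain y where y: "0 < y" "ereal y < liminf (\<lambda>n. ereal (f n))"
    using ereal_dense2[OF assms] unfolding f_def[symmetric] by auto
  then obtain N where N: "\<And>n. n \<ge> N \<Longrightarrow> y < f n"
    using less_LiminfD[OF y(2)] unfolding eventually_sequentially by auto
  have pos: "f n > 0" if "n \<ge> 1" for n
  proof (rule ccontr)
    assume "\<not> f n > 0"
    then have "max (dist_int (real n * a)) (dist_int (real n * b)) \<le> 0"
      using that unfolding f_def by (simp add: zero_less_mult_iff not_less)
    then have z: "dist_int (real n * a) = 0" "dist_int (real n * b) = 0"
      using dist_int_nonneg[of "real n * a"] dist_int_nonneg[of "real n * b"] by auto
    have "dist_int (real (n * Suc N) * s) = 0" if "dist_int (real n * s) = 0" for s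
    proof -
      obtain m where "dist_int (real n * s) = \<bar>real n * s - of_int m\<bar>" by (rule dist_int_attained)
      then have "real n * s = of_int m" using that by simp
      then have "real (n * Suc N) * s = of_int (m * int (Suc N))" by (simp add: algebra_simps)
      then show ?thesis
        using dist_int_le[of "real (n * Suc N) * s" "m * int (Suc N)"] dist_int_nonneg by (simp add: antisym)
    qed
    then have "f (n * Suc N) = 0" using z unfolding f_def by simp
    moreover have "n * Suc N \<ge> N" using that by (cases n) auto
    ultimately show False using N[of "n * Suc N"] y(1) by simp
  qed
  define \<kappa> where "\<kappa> = Min (insert y (f ` {1..N}))"
  have "\<kappa> > 0" unfolding \<kappa>_def using y(1) pos by (subst Min_gr_iff) auto
  moreover have "\<kappa> \<le> f n" if "n \<ge> 1" for n
  proof (cases "n \<le> N")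
    case True
    then show ?thesis unfolding \<kappa>_def using that by (intro Min_le) auto
  next
    case False
    have "\<kappa> \<le> y" unfolding \<kappa>_def by (intro Min_le) auto
    then show ?thesis using N[of n] False by simp
  qed
  ultimately show ?thesis using that unfolding f_def by blast
qed

text \<open>The assertion is that a rational line \<open>A x + B y + C = 0\<close> of height at most \<open>q\<close> which
  comes within \<open>c / q\<close> of a bounded piece of the line \<open>y = a x + b\<close> is not nearly parallel
  to it.\<close>

definition transversal :: "real \<Rightarrow> real \<Rightarrow> real \<Rightarrow> real \<Rightarrow> real \<Rightarrow> bool" where
  "transversal i j a b \<epsilon> \<longleftrightarrow> (\<forall>X>0. \<exists>\<kappa>>0. \<exists>c>0. \<forall>(q::int) (A::int) (B::int) (C::int) (x::real).
     (1::int) \<le> q \<longrightarrow> (A, B) \<noteq> (0, 0) \<longrightarrow> \<bar>real_of_int A\<bar> \<le> q powr i \<longrightarrow> \<bar>real_of_int B\<bar> \<le> q powr j \<longrightarrow>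
     \<bar>x\<bar> \<le> X \<longrightarrow> \<bar>of_int A * x + of_int B * (a * x + b) + of_int C\<bar> \<le> c / q \<longrightarrow>
     \<kappa> * q powr (\<epsilon> - 1) \<le> \<bar>of_int A + a * of_int B\<bar>)"

text \<open>If \<open>D = A + a B\<close> were too small, then \<open>B \<noteq> 0\<close>, and
  \<open>n = \<bar>B\<bar>\<close> would bring both \<open>n a\<close> and \<open>n b\<close> too
  close to integers: the first is within \<open>\<bar>D\<bar>\<close> of one, and
  \<open>B b + C\<close> is the value of the linear form minus \<open>D x\<close>. As
  \<open>n\<close> is at most a constant times \<open>q powr \<sigma>\<close>, this contradicts
  \<open>bound\<close>.\<close>

lemma transversal_of_uniform_bound:
  fixes i j \<sigma> a b \<epsilon> \<kappa> :: real
  assumes ij: "0 < i" "0 < j" "i + j = 1" and \<sigma>: "\<sigma> = min i j" and a: "a \<noteq> 0"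
    and \<epsilon>: "0 \<le> \<epsilon>" "\<epsilon> \<le> 1" and \<kappa>: "\<kappa> > 0"
    and bound: "\<And>n::nat. n \<ge> 1 \<Longrightarrow>
      \<kappa> \<le> real n powr (1/\<sigma> - \<epsilon>) * max (dist_int (real n * a)) (dist_int (real n * b))"
  shows "transversal i j a b (\<epsilon> * \<sigma>)"
  unfolding transversal_def
proof (intro allI impI)
  fix X :: real assume X: "X > 0"
  \<comment> \<open>If \<sigma> is \<open>j\<close>, the bound on \<open>B\<close> suffices. If
    \<sigma> is \<open>i\<close>, the estimate is \<open>\<bar>a B\<bar> \<le> \<bar>A\<bar> +
    \<bar>D\<bar> \<le> 2 q powr i\<close>, whence the factor
    \<open>2 / \<bar>a\<bar>\<close>.\<close>
  define M where "M = max 1 (2 / \<bar>a\<bar>)"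
  define \<tau> where "\<tau> = 1/\<sigma> - \<epsilon>"
  have s: "0 < \<sigma>" "\<sigma> \<le> 1/2" using ij \<sigma> by (auto simp: min_def)
  have "1 \<le> 1/\<sigma>" using s by simp
  then have \<tau>: "\<tau> \<ge> 0" using \<epsilon> unfolding \<tau>_def by linarith
  have \<sigma>\<tau>: "\<sigma> * \<tau> = 1 - \<epsilon> * \<sigma>" using s unfolding \<tau>_def by (simp add: field_simps)
  have "\<epsilon> * \<sigma> \<le> 1 * \<sigma>" using s \<epsilon> by (intro mult_right_mono) auto
  then have \<epsilon>\<sigma>: "0 \<le> \<epsilon> * \<sigma>" "\<epsilon> * \<sigma> \<le> 1" using s \<epsilon> by (simp, linarith)
  have M: "M \<ge> 1" unfolding M_def by simp
  \<comment> \<open>This one number serves as both constants of \<open>transversal\<close>. It is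
    small enough that the assumed failure bounds the quantity in \<open>bound\<close> by
    \<open>\<kappa> / 2\<close>.\<close>
  define \<kappa>0 where "\<kappa>0 = min 1 (\<kappa> / (2 * (1 + X) * M powr \<tau>))"
  have \<kappa>0: "0 < \<kappa>0" "\<kappa>0 \<le> 1" unfolding \<kappa>0_def using \<kappa> X M by auto
  have "\<kappa>0 \<le> \<kappa> / (2 * (1 + X) * M powr \<tau>)" unfolding \<kappa>0_def by simp
  then have \<kappa>0': "M powr \<tau> * (\<kappa>0 * (1 + X)) \<le> \<kappa> / 2"
    using X M by (subst (asm) pos_le_divide_eq) (simp, simp add: algebra_simps)
  have "\<kappa>0 * q powr (\<epsilon> * \<sigma> - 1) \<le> \<bar>of_int A + a * of_int B\<bar>"
    if q: "(1::int) \<le> q" and AB: "(A, B) \<noteq> (0, 0)" and A: "\<bar>real_of_int A\<bar> \<le> q powr i"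
      and B: "\<bar>real_of_int B\<bar> \<le> q powr j" and x: "\<bar>x\<bar> \<le> X"
      and L: "\<bar>of_int A * x + of_int B * (a * x + b) + of_int C\<bar> \<le> \<kappa>0 / q" for q A B C :: int and x :: real
  proof (rule ccontr)
    define D where "D = of_int A + a * of_int B"
    define z where "z = real_of_int q powr (\<epsilon> * \<sigma> - 1)"
    assume "\<not> ?thesis"
    then have D: "\<bar>D\<bar> < \<kappa>0 * z" unfolding D_def z_def by simp
    have q1: "real_of_int q \<ge> 1" using q by simp
    have z1: "0 < z" "z \<le> 1" unfolding z_def using q1 \<epsilon>\<sigma>
      powr_mono[of "\<epsilon> * \<sigma> - 1" 0 "real_of_int q"] by auto
    have D1: "\<bar>D\<bar> < 1" using D \<kappa>0 z1 mult_mono[of \<kappa>0 1 z 1] by auto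
    have B0: "B \<noteq> 0"
    proof
      assume "B = 0"
      then have "\<bar>real_of_int A\<bar> < 1" using D1 unfolding D_def by simp
      then have "A = 0" by linarith
      then show False using AB \<open>B = 0\<close> by simp
    qed
    define n where "n = nat \<bar>B\<bar>"
    have n: "n \<ge> 1" "real n = \<bar>real_of_int B\<bar>" unfolding n_def using B0 by auto
    have nM: "real n \<le> M * q powr \<sigma>"
    proof (cases "j \<le> i")
      case True
      then have "real n \<le> q powr \<sigma>" using B n \<sigma> by (simp add: min_def)
      also have "\<dots> \<le> M * q powr \<sigma>" using M mult_right_mono[of 1 M "q powr \<sigma>"] by simp
      finally show ?thesis .
    next
      case False
      have "\<bar>a\<bar> * real n = \<bar>D - of_int A\<bar>" unfolding D_def n by (simp add: abs_mult)
      also have "\<dots> \<le> 1 + q powr i" using D1 A by linarith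
      also have "\<dots> \<le> 2 * q powr i" using q1 ij ge_one_powr_ge_zero[of q i] by simp
      finally have "real n \<le> 2 / \<bar>a\<bar> * q powr i" using a by (simp add: field_simps)
      also have "\<dots> \<le> M * q powr i" unfolding M_def by (intro mult_right_mono) auto
      finally show ?thesis using False \<sigma> by (simp add: min_def)
    qed
    have "dist_int (real n * a) \<le> \<bar>D\<bar>"
    proof (cases "B > 0")
      case True
      then have "real n = B" using n by simp
      then show ?thesis using dist_int_le[of "real n * a" "-A"] unfolding D_def by (simp add: algebra_simps)
    next
      case False
      then have e: "real n = - B" using n by simp
      show ?thesis using dist_int_le[of "real n * a" "A"] unfolding D_def e
        by (simp add: algebra_simps abs_minus_commute)
    qed
    then have 1: "dist_int (real n * a) \<le> \<kappa>0 * z" using D by simp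
    have "\<bar>of_int B * b + of_int C\<bar> = \<bar>(of_int A * x + of_int B * (a * x + b) + of_int C) - D * x\<bar>"
      unfolding D_def by (simp add: algebra_simps)
    also have "\<dots> \<le> \<kappa>0 / q + \<bar>D\<bar> * \<bar>x\<bar>" using L by (simp flip: abs_mult)
    also have "\<dots> \<le> \<kappa>0 * z + \<kappa>0 * z * X"
    proof (intro add_mono mult_mono)
      have "1 / real_of_int q = q powr (- 1)" using q1 by (simp add: powr_minus_divide)
      also have "\<dots> \<le> z" unfolding z_def using q1 \<epsilon>\<sigma> by (intro powr_mono) auto
      finally show "\<kappa>0 / q \<le> \<kappa>0 * z" using \<kappa>0 mult_left_mono[of "1/q" z \<kappa>0] by simp
    qed (use D x \<kappa>0 z1 in auto)
    finally have Bb: "\<bar>of_int B * b + of_int C\<bar> \<le> \<kappa>0 * z * (1 + X)" by (simp add: algebra_simps)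
    have 2: "dist_int (real n * b) \<le> \<kappa>0 * z * (1 + X)"
    proof (cases "B > 0")
      case True
      then have e: "real n = B" using n by simp
      show ?thesis using dist_int_le[of "real n * b" "-C"] Bb unfolding e by (simp add: algebra_simps)
    next
      case False
      then have e: "real n = - B" using n by simp
      show ?thesis using dist_int_le[of "real n * b" "C"] Bb unfolding e
        by (simp add: algebra_simps abs_minus_commute)
    qed
    have "\<kappa>0 * z * 1 \<le> \<kappa>0 * z * (1 + X)" using \<kappa>0 z1 X by (intro mult_left_mono) auto
    then have 3: "max (dist_int (real n * a)) (dist_int (real n * b)) \<le> \<kappa>0 * z * (1 + X)"
      using 1 2 by simp
    have "real n powr \<tau> \<le> (M * q powr \<sigma>) powr \<tau>"
      using nM \<tau> by (intro powr_mono2) auto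
    also have "\<dots> = M powr \<tau> * q powr (1 - \<epsilon> * \<sigma>)"
      using M by (simp add: powr_mult powr_powr \<sigma>\<tau>)
    finally have 4: "real n powr \<tau> \<le> M powr \<tau> * q powr (1 - \<epsilon> * \<sigma>)" .
    have "\<kappa> \<le> real n powr \<tau> * max (dist_int (real n * a)) (dist_int (real n * b))"
      unfolding \<tau>_def by (rule bound[OF n(1)])
    also have "\<dots> \<le> (M powr \<tau> * q powr (1 - \<epsilon> * \<sigma>)) * (\<kappa>0 * z * (1 + X))"
      using 3 4 dist_int_nonneg[of "real n * a"] by (intro mult_mono) auto
    also have "\<dots> = M powr \<tau> * (\<kappa>0 * (1 + X)) * (q powr (1 - \<epsilon> * \<sigma>) * z)"
      by simp
    also have "q powr (1 - \<epsilon> * \<sigma>) * z = 1" unfolding z_def using q1 by (simp flip: powr_add)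
    finally show False using \<kappa>0' \<kappa> by simp
  qed
  then show "\<exists>\<kappa>>0. \<exists>c>0. \<forall>(q::int) (A::int) (B::int) (C::int) (x::real).
     (1::int) \<le> q \<longrightarrow> (A, B) \<noteq> (0, 0) \<longrightarrow> \<bar>real_of_int A\<bar> \<le> q powr i \<longrightarrow> \<bar>real_of_int B\<bar> \<le> q powr j \<longrightarrow>
     \<bar>x\<bar> \<le> X \<longrightarrow> \<bar>of_int A * x + of_int B * (a * x + b) + of_int C\<bar> \<le> c / q \<longrightarrow>
     \<kappa> * q powr (\<epsilon> * \<sigma> - 1) \<le> \<bar>of_int A + a * of_int B\<bar>"
    using \<kappa>0(1) by blast
qed

text \<open>With \<open>a = m / d\<close>, the number \<open>A + a B\<close> is an integer multiple
  of \<open>1 / d\<close>. Exponent 0 already forces it to be nonzero, hence it is at least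
  \<open>1 / d\<close> in modulus.\<close>

lemma transversal_rational:
  assumes "a \<in> \<rat>" "transversal i j a b 0"
  shows "transversal i j a b 1"
  unfolding transversal_def
proof (intro allI impI)
  fix X :: real assume "X > 0"
  obtain m d :: int where md: "d > 0" "a = m / d"
    using assms(1) by (metis Rats_cases')
  obtain \<kappa> c where "\<kappa> > 0" "c > 0" and
    T: "\<And>(q::int) (A::int) (B::int) (C::int) (x::real).
     (1::int) \<le> q \<Longrightarrow> (A, B) \<noteq> (0, 0) \<Longrightarrow> \<bar>real_of_int A\<bar> \<le> q powr i \<Longrightarrow> \<bar>real_of_int B\<bar> \<le> q powr j \<Longrightarrow>
     \<bar>x\<bar> \<le> X \<Longrightarrow> \<bar>of_int A * x + of_int B * (a * x + b) + of_int C\<bar> \<le> c / q \<Longrightarrow>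
     \<kappa> * q powr (0 - 1) \<le> \<bar>of_int A + a * of_int B\<bar>"
    using assms(2) \<open>X > 0\<close> unfolding transversal_def by blast
  have "1 / d * q powr (1 - 1) \<le> \<bar>of_int A + a * of_int B\<bar>"
    if "(1::int) \<le> q" "(A, B) \<noteq> (0, 0)" "\<bar>real_of_int A\<bar> \<le> q powr i" "\<bar>real_of_int B\<bar> \<le> q powr j"
     "\<bar>x\<bar> \<le> X" "\<bar>of_int A * x + of_int B * (a * x + b) + of_int C\<bar> \<le> c / q" for q A B C :: int and x
  proof -
    have "0 < \<kappa> * q powr (0 - 1)" using \<open>\<kappa> > 0\<close> that(1) by simp
    then have "of_int A + a * of_int B \<noteq> 0" using T[OF that] by auto
    moreover have e: "of_int A + a * of_int B = of_int (A * d + m * B) / d" using md by (simp add: field_simps)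
    ultimately have "A * d + m * B \<noteq> 0" by (metis div_0 of_int_0)
    then have "1 \<le> \<bar>A * d + m * B\<bar>" by linarith
    then have "1 \<le> \<bar>real_of_int (A * d + m * B)\<bar>" by linarith
    then show ?thesis unfolding e using md that(1) by (simp add: divide_right_mono)
  qed
  then show "\<exists>\<kappa>>0. \<exists>c>0. \<forall>(q::int) (A::int) (B::int) (C::int) (x::real).
     (1::int) \<le> q \<longrightarrow> (A, B) \<noteq> (0, 0) \<longrightarrow> \<bar>real_of_int A\<bar> \<le> q powr i \<longrightarrow> \<bar>real_of_int B\<bar> \<le> q powr j \<longrightarrow>
     \<bar>x\<bar> \<le> X \<longrightarrow> \<bar>of_int A * x + of_int B * (a * x + b) + of_int C\<bar> \<le> c / q \<longrightarrow>
     \<kappa> * q powr (1 - 1) \<le> \<bar>of_int A + a * of_int B\<bar>"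
    using md(1) \<open>c > 0\<close> by (intro exI[of _ "1 / d"] conjI exI[of _ c]) auto
qed

text \<open>This is the same line written as \<open>x = y / a - b / a\<close>. Exchanging
  \<open>A\<close> and \<open>B\<close> divides the slope by \<open>\<bar>a\<bar>\<close>, and
  \<open>X'\<close> bounds \<open>x\<close> when \<open>y\<close> is bounded by
  \<open>X\<close>.\<close>

lemma transversal_swap:
  assumes "a \<noteq> 0" "transversal i j a b \<epsilon>"
  shows "transversal j i (1/a) (- b/a) \<epsilon>"
  unfolding transversal_def
proof (intro allI impI)
  fix X :: real assume X: "X > 0"
  define X' where "X' = (X + \<bar>b\<bar>) / \<bar>a\<bar>"
  have "X' > 0" unfolding X'_def using X assms(1) by (auto intro!: divide_pos_pos)
  then obtain \<kappa> c where \<kappa>c: "\<kappa> > 0" "c > 0" and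
    T: "\<And>(q::int) (A::int) (B::int) (C::int) (x::real).
     (1::int) \<le> q \<Longrightarrow> (A, B) \<noteq> (0, 0) \<Longrightarrow> \<bar>real_of_int A\<bar> \<le> q powr i \<Longrightarrow> \<bar>real_of_int B\<bar> \<le> q powr j \<Longrightarrow>
     \<bar>x\<bar> \<le> X' \<Longrightarrow> \<bar>of_int A * x + of_int B * (a * x + b) + of_int C\<bar> \<le> c / q \<Longrightarrow>
     \<kappa> * q powr (\<epsilon> - 1) \<le> \<bar>of_int A + a * of_int B\<bar>"
    using assms(2) unfolding transversal_def by blast
  have "\<kappa> / \<bar>a\<bar> * q powr (\<epsilon> - 1) \<le> \<bar>of_int A + 1/a * of_int B\<bar>"
    if h: "(1::int) \<le> q" "(A, B) \<noteq> (0, 0)" "\<bar>real_of_int A\<bar> \<le> q powr j" "\<bar>real_of_int B\<bar> \<le> q powr i"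
     "\<bar>y\<bar> \<le> X" "\<bar>of_int A * y + of_int B * (1/a * y + - b/a) + of_int C\<bar> \<le> c / q" for q A B C :: int and y
  proof -
    define x where "x = (y - b) / a"
    have y: "y = a * x + b" unfolding x_def using assms(1) by simp
    have "\<bar>x\<bar> \<le> X'" unfolding x_def X'_def using h(5)
      by (simp add: abs_divide divide_right_mono)
    moreover have "of_int B * x + of_int A * (a * x + b) + of_int C = of_int A * y + of_int B * (1/a * y + - b/a) + of_int C"
      unfolding y using assms(1) by (simp add: field_simps)
    ultimately have "\<kappa> * q powr (\<epsilon> - 1) \<le> \<bar>of_int B + a * of_int A\<bar>"
      using h by (intro T[of q B A x C]) auto
    also have "of_int B + a * of_int A = a * (of_int A + 1/a * of_int B)"
      using assms(1) by (simp add: field_simps)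
    also have "\<bar>a * (of_int A + 1/a * of_int B)\<bar> = \<bar>a\<bar> * \<bar>of_int A + 1/a * of_int B\<bar>"
      by (rule abs_mult)
    finally show ?thesis using assms(1) by (simp add: field_simps)
  qed
  then show "\<exists>\<kappa>>0. \<exists>c>0. \<forall>(q::int) (A::int) (B::int) (C::int) (x::real).
     (1::int) \<le> q \<longrightarrow> (A, B) \<noteq> (0, 0) \<longrightarrow> \<bar>real_of_int A\<bar> \<le> q powr j \<longrightarrow> \<bar>real_of_int B\<bar> \<le> q powr i \<longrightarrow>
     \<bar>x\<bar> \<le> X \<longrightarrow> \<bar>of_int A * x + of_int B * (1/a * x + - b/a) + of_int C\<bar> \<le> c / q \<longrightarrow>
     \<kappa> * q powr (\<epsilon> - 1) \<le> \<bar>of_int A + 1/a * of_int B\<bar>"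
    using \<kappa>c assms(1) by (intro exI[of _ "\<kappa> / \<bar>a\<bar>"] conjI exI[of _ c]) auto
qed

text \<open>Pigeonhole principle: there are more than \<open>q\<close> pairs with entries in
  \<open>{0..M}\<close> and \<open>{0..N}\<close>, so two of them give the same residue of
  \<open>x p + y r\<close> modulo \<open>q\<close>; their difference is the line.\<close>

lemma attached_line_exists:
  fixes q p r :: int
  assumes "i + j = 1" "(1::int) \<le> q"
  obtains A B C :: int where "(A, B) \<noteq> (0, 0)" "A * p + B * r + C * q = 0"
    "\<bar>real_of_int A\<bar> \<le> q powr i" "\<bar>real_of_int B\<bar> \<le> q powr j"
proof -
  define M N where "M = \<lfloor>real_of_int q powr i\<rfloor>" and "N = \<lfloor>real_of_int q powr j\<rfloor>"
  have MN: "M \<ge> 0" "N \<ge> 0" unfolding M_def N_def by auto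
  define f where "f = (\<lambda>(x, y). (x * p + y * r) mod q)"
  have "real_of_int q = q powr i * q powr j"
    using assms by (simp flip: powr_add)
  also have "\<dots> < (of_int M + 1) * (of_int N + 1)"
    unfolding M_def N_def using assms(2) by (intro mult_strict_mono) (auto simp: add_nonneg_pos)
  finally have "real_of_int q < of_int ((M + 1) * (N + 1))" by simp
  then have "q < (M + 1) * (N + 1)" by linarith
  then have "nat q < nat (M + 1) * nat (N + 1)"
    using MN by (simp flip: nat_mult_distrib)
  then have "card {0..<q} < card ({0..M} \<times> {0..N})" by simp
  moreover have "f ` ({0..M} \<times> {0..N}) \<subseteq> {0..<q}" unfolding f_def using assms(2) by auto
  ultimately have "\<not> inj_on f ({0..M} \<times> {0..N})"
    by (metis card_inj_on_le finite_atLeastLessThan_int not_le)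
  then obtain x y x' y' where xy: "x \<in> {0..M}" "x' \<in> {0..M}" "y \<in> {0..N}" "y' \<in> {0..N}"
    "(x, y) \<noteq> (x', y')" "(x * p + y * r) mod q = (x' * p + y' * r) mod q"
    unfolding inj_on_def f_def by auto
  then obtain k where k: "(x * p + y * r) - (x' * p + y' * r) = q * k"
    by (metis mod_eq_dvd_iff dvdE)
  show ?thesis
  proof (rule that[of "x - x'" "y - y'" "- k"])
    show "(x - x', y - y') \<noteq> (0, 0)" using xy(5) by auto
    show "(x - x') * p + (y - y') * r + - k * q = 0" using k by (simp add: algebra_simps)
    have "\<bar>x - x'\<bar> \<le> M" "\<bar>y - y'\<bar> \<le> N" using xy by auto
    then show "\<bar>real_of_int (x - x')\<bar> \<le> q powr i" "\<bar>real_of_int (y - y')\<bar> \<le> q powr j"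
      unfolding M_def N_def by linarith+
  qed
qed


section \<open>Dangerous sets\<close>

lemma powr_le_mult_powr:
  fixes x y K s :: real
  assumes "0 < x" "0 < y" "y \<le> K * x" "1 \<le> K" "0 \<le> s" "s \<le> 1"
  shows "y powr s \<le> K * x powr s"
proof -
  have "y powr s \<le> (K * x) powr s" using assms by (intro powr_mono2) auto
  also have "\<dots> = K powr s * x powr s" using assms by (simp add: powr_mult)
  also have "\<dots> \<le> K * x powr s"
    using assms powr_mono[of s 1 K] by (intro mult_right_mono) auto
  finally show ?thesis .
qed

lemma powr_minus_le_mult_powr:
  fixes x y K s :: real
  assumes "0 < x" "0 < y" "y \<le> K * x" "1 \<le> K" "0 \<le> s" "s \<le> 1"
  shows "x powr (- s) \<le> K * y powr (- s)"
proof -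
  have "y powr s \<le> K * x powr s" using assms by (rule powr_le_mult_powr)
  then show ?thesis using assms by (simp add: powr_minus field_simps)
qed

lemma geometric_level_exists:
  fixes z l R :: real
  assumes "0 < z" "z \<le> l" "R > 1"
  obtains n where "l * (1/R) ^ Suc n < z" "z \<le> l * (1/R) ^ n"
proof -
  have l: "l > 0" using assms by simp
  obtain N where "(1/R) ^ N < z / l"
    using real_arch_pow_inv[of "z / l" "1/R"] assms l by auto
  then have N: "l * (1/R) ^ N < z" using l by (simp add: field_simps)
  define k where "k = (LEAST k. l * (1/R) ^ k < z)"
  have k: "l * (1/R) ^ k < z" unfolding k_def using N by (rule LeastI)
  then have "k \<noteq> 0" using assms by (intro notI) simp
  then obtain n where n: "k = Suc n" by (cases k) auto
  have "\<not> l * (1/R) ^ n < z" using not_less_Least[of n "\<lambda>k. l * (1/R) ^ k < z"] n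
    unfolding k_def by simp
  then show ?thesis using that[of n] k n by simp
qed

lemma power_level_exists:
  fixes z G :: real
  assumes "1 \<le> z" "G > 1"
  obtains t where "G ^ t \<le> z" "z < G ^ Suc t"
proof -
  obtain N where N: "z < G ^ N" using real_arch_pow[OF assms(2)] by blast
  define k where "k = (LEAST k. z < G ^ k)"
  have k: "z < G ^ k" unfolding k_def using N by (rule LeastI)
  then have "k \<noteq> 0" using assms by (intro notI) simp
  then obtain n where n: "k = Suc n" by (cases k) auto
  have "\<not> z < G ^ n" using not_less_Least[of n "\<lambda>k. z < G ^ k"] n unfolding k_def by simp
  then show ?thesis using that[of n] k n by simp
qed

text \<open>The first ball is \<open>{u0..u0 + l}\<close>, and each round shrinks lengths by
  \<open>R\<close>. The two conditions on \<open>g\<close> make powers of \<open>G = R ^ g\<close>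
  beat those of \<open>R\<close>: the one with \<epsilon> bounds \<open>R ^ t\<close> by a multiple
  of \<open>q powr \<epsilon>\<close>, and the one with \<open>j\<close> gives
  \<open>(G ^ t) powr j \<ge> R ^ (3 * t)\<close>. The bounds on \<kappa> make every group start
  inside the first ball, force certain integers to have modulus below 1, and make
  \<open>transversal\<close> applicable. The size of \<open>t0\<close> absorbs the remaining
  constants in high classes.\<close>

locale dangerous_sets =
  fixes i j a b \<gamma> \<delta> u0 l R X \<kappa>0 c0 \<epsilon> \<kappa> :: real and g t0 :: nat
  assumes ij: "0 < j" "j \<le> i" "i + j = 1"
    and l: "l > 0" and R: "R \<ge> 4"
    and X: "{u0..u0 + l} \<subseteq> {-X..X}"
    and \<kappa>0: "0 < \<kappa>0" "\<kappa>0 \<le> 1" and c0: "0 < c0"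
    and transversal: "\<And>(q::int) (A::int) (B::int) (C::int) (x::real).
     (1::int) \<le> q \<Longrightarrow> (A, B) \<noteq> (0, 0) \<Longrightarrow> \<bar>real_of_int A\<bar> \<le> q powr i \<Longrightarrow> \<bar>real_of_int B\<bar> \<le> q powr j \<Longrightarrow>
     \<bar>x\<bar> \<le> X \<Longrightarrow> \<bar>of_int A * x + of_int B * (a * x + b) + of_int C\<bar> \<le> c0 / q \<Longrightarrow>
     \<kappa>0 * q powr (\<epsilon> - 1) \<le> \<bar>of_int A + a * of_int B\<bar>"
    and \<epsilon>: "0 < \<epsilon>" "2 \<le> real g * \<epsilon>" and gj: "3 \<le> real g * j"
    and \<kappa>: "0 < \<kappa>" "\<kappa> * (1 + \<bar>a\<bar>) \<le> l * \<kappa>0\<^sup>2" "\<kappa> * (8 * R\<^sup>2 * R ^ g * (1 + \<bar>a\<bar>)) \<le> \<kappa>0" "\<kappa> \<le> c0"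
    and t0: "(1 + \<bar>a\<bar>) ^ 4 * 64 * R ^ (12 + 3 * g) \<le> R ^ t0"
begin

definition "W = 1 + \<bar>a\<bar>"
definition "G = R ^ g"
definition len :: "nat \<Rightarrow> real" where "len n = l * (1/R) ^ n"
text \<open>A homogeneous point of height \<open>q\<close> has been left behind once the ball has
  length at most \<open>c1 * q powr (- 1 - i)\<close>; \<open>c\<close> is the radius constant of
  these points. An inhomogeneous point is treated at length about
  \<open>\<kappa>' * q powr (- 1 - i)\<close> with radius constant \<open>c'\<close>. Here
  \<open>\<kappa>'\<close> is so small that the difference of two such points is near with constant
  \<open>c\<close>, and \<open>c'\<close> so small that two points with the same centre differ by at
  most \<open>len (n + 7)\<close>.\<close>

definition c1 :: real where "c1 = \<kappa> / (W * R ^ (8 + t0))"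
definition c :: real where "c = c1 / 4"
definition \<kappa>' :: real where "\<kappa>' = c / (R ^ 3 * (2 + \<bar>a\<bar>))"
definition c' :: real where "c' = \<kappa>' / (2 * R ^ 7)"

text \<open>The centre is real, so that it can be an integer point shifted by
  \<open>(\<gamma>, \<delta>)\<close>.\<close>

definition near :: "real \<Rightarrow> int \<Rightarrow> real \<Rightarrow> real \<Rightarrow> real \<Rightarrow> bool" where
  "near e q p r x \<longleftrightarrow> \<bar>q * x - p\<bar> \<le> e * q powr (- i) \<and> \<bar>q * (a * x + b) - r\<bar> \<le> e * q powr (- j)"

definition attached :: "int \<Rightarrow> int \<Rightarrow> int \<Rightarrow> int \<Rightarrow> int \<Rightarrow> int \<Rightarrow> bool" where
  "attached q p r A B C \<longleftrightarrow> (A, B) \<noteq> (0, 0) \<and> A * p + B * r + C * q = 0 \<and>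
     \<bar>real_of_int A\<bar> \<le> q powr i \<and> \<bar>real_of_int B\<bar> \<le> q powr j"

definition slope :: "int \<Rightarrow> int \<Rightarrow> real" where
  "slope A B = \<bar>of_int A + a * of_int B\<bar>"

text \<open>The restriction to \<open>y = a x + b\<close> of the affine form of a rational line;
  \<open>slope\<close> is the modulus of its derivative in \<open>x\<close>.\<close>

definition form :: "int \<Rightarrow> int \<Rightarrow> int \<Rightarrow> real \<Rightarrow> real" where
  "form A B C x = of_int A * x + of_int B * (a * x + b) + of_int C"

text \<open>The truncated subtraction \<open>t - t0\<close> is intended: the classes \<open>t \<le> t0\<close> are treated when the
  ball has length about \<open>\<kappa> / (q D)\<close>, the others earlier.\<close>

definition graded :: "nat \<Rightarrow> nat \<Rightarrow> int \<Rightarrow> int \<Rightarrow> int \<Rightarrow> bool" where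
  "graded n t q A B \<longleftrightarrow> slope A B > 0 \<and>
     G ^ t \<le> W * q powr i / slope A B \<and> W * q powr i / slope A B < G ^ Suc t \<and>
     len (Suc n) < \<kappa> * R ^ (t - t0) / (q * slope A B) \<and>
     \<kappa> * R ^ (t - t0) / (q * slope A B) \<le> len n"

definition hit :: "nat \<Rightarrow> nat \<Rightarrow> real \<Rightarrow> int \<Rightarrow> int \<Rightarrow> int \<Rightarrow> int \<Rightarrow> int \<Rightarrow> int \<Rightarrow> bool" where
  "hit n t x q p r A B C \<longleftrightarrow> 1 \<le> q \<and> attached q p r A B C \<and> near c q p r x \<and> graded n t q A B"

text \<open>Class 0 consists of the inhomogeneous points, graded by height alone. The homogeneous
  points of class \<open>t\<close> are stored under \<open>Suc t\<close>, which turns the shift 7 of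
  the potential into the 8 in the estimates for them.\<close>

definition danger :: "nat \<Rightarrow> nat \<Rightarrow> real set" where
  "danger n m = (case m of
     0 \<Rightarrow> {x. \<exists>q p r. 1 \<le> q \<and> near c' q (of_int p + \<gamma>) (of_int r + \<delta>) x \<and>
             len (Suc n) < \<kappa>' * q powr (- 1 - i) \<and> \<kappa>' * q powr (- 1 - i) \<le> len n}
   | Suc t \<Rightarrow> {x. \<exists>q p r A B C. hit n t x q p r A B C})"

lemma i_bounds: "0 < i" "i < 1" "j < 1" "1/2 \<le> i" using ij by auto
lemma W: "W \<ge> 1" "W > 0" by (auto simp: W_def)
lemma R0: "R > 0" "R \<ge> 1" "R > 1" using R by auto
lemma g0: "g > 0" using \<epsilon> by (cases g) auto
lemma G: "G \<ge> R" "G \<ge> 1" "G > 0" "G > 1"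
proof -
  have "R ^ 1 \<le> R ^ g" using R0 g0 by (intro power_increasing) auto
  then show "G \<ge> R" "G \<ge> 1" "G > 0" "G > 1" using R0 unfolding G_def by auto
qed
lemma len_pos: "len n > 0" using l R0 by (simp add: len_def)
lemma len_Suc: "len n = R * len (Suc n)" using R0 by (simp add: len_def)
lemma len_add: "len (n + k) = len n / R ^ k" by (simp add: len_def power_add power_divide)
lemma len_less_iff: "len m \<le> len n \<longleftrightarrow> n \<le> m"
  using R0 l power_strict_decreasing_iff[of "1/R" n m] power_decreasing_iff[of "1/R" m n]
  by (auto simp: len_def)
lemma c_pos: "c1 > 0" "c > 0" "\<kappa>' > 0" "c' > 0"
  using \<kappa> W R0 by (simp_all add: c1_def c_def \<kappa>'_def c'_def)
lemma c1_le: "c1 \<le> \<kappa>"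
proof -
  have "1 * 1 \<le> W * R ^ (8 + t0)" using W R0 by (intro mult_mono one_le_power) auto
  then show ?thesis using \<kappa> unfolding c1_def by (simp add: divide_le_eq)
qed
lemma c_le: "c \<le> \<kappa> / 4" using c1_le by (simp add: c_def)

section \<open>Lines attached to a rational point, and their groups\<close>

lemma slope_nonneg: "slope A B \<ge> 0" by (simp add: slope_def)

lemma slope_le:
  assumes "1 \<le> q" "attached q p r A B C"
  shows "slope A B \<le> W * q powr i"
proof -
  have "real_of_int q powr j \<le> q powr i" using assms ij by (intro powr_mono) auto
  then have "\<bar>real_of_int B\<bar> \<le> q powr i" using assms by (simp add: attached_def)
  then have "\<bar>a\<bar> * \<bar>real_of_int B\<bar> \<le> \<bar>a\<bar> * q powr i" by (intro mult_left_mono) auto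
  moreover have "slope A B \<le> \<bar>real_of_int A\<bar> + \<bar>a\<bar> * \<bar>real_of_int B\<bar>"
    unfolding slope_def by (simp flip: abs_mult)
  ultimately show ?thesis using assms unfolding W_def attached_def by (simp add: algebra_simps)
qed

lemma form_diff: "\<bar>form A B C x - form A B C y\<bar> = slope A B * \<bar>x - y\<bar>"
  unfolding form_def slope_def abs_mult[symmetric] by (simp add: algebra_simps)

text \<open>The form vanishes at the rational point, so \<open>q\<close> times its value is
  \<open>A (q x - p) + B (q (a x + b) - r)\<close>; in each product the powers of \<open>q\<close>
  cancel.\<close>

lemma form_le:
  assumes "1 \<le> q" "attached q p r A B C" "near e q p r x"
  shows "\<bar>form A B C x\<bar> \<le> 2 * e / q"
proof -
  have q: "real_of_int q > 0" using assms by simp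
  have "0 \<le> e * q powr (- i)" using assms(3) unfolding near_def by linarith
  then have e: "e \<ge> 0" using q by (simp add: zero_le_mult_iff)
  have "real_of_int (A * p + B * r + C * q) = 0" using assms(2) unfolding attached_def by simp
  then have "q * form A B C x = A * (q * x - p) + B * (q * (a * x + b) - r)"
    unfolding form_def by (simp add: algebra_simps)
  then have "\<bar>q * form A B C x\<bar> \<le> \<bar>real_of_int A\<bar> * \<bar>q * x - p\<bar> + \<bar>real_of_int B\<bar> * \<bar>q * (a * x + b) - r\<bar>"
    unfolding abs_mult[symmetric] by (simp only: abs_triangle_ineq)
  also have "\<dots> \<le> q powr i * (e * q powr (- i)) + q powr j * (e * q powr (- j))"
    using assms unfolding attached_def near_def by (intro add_mono mult_mono) auto
  also have "\<dots> = 2 * e" using q by (simp add: powr_minus field_simps)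
  finally show ?thesis using q by (simp add: abs_mult field_simps)
qed

lemma slope_ge:
  assumes "1 \<le> q" "attached q p r A B C" "near c q p r x" "\<bar>x\<bar> \<le> X"
  shows "\<kappa>0 * q powr (\<epsilon> - 1) \<le> slope A B"
proof -
  have "\<bar>form A B C x\<bar> \<le> 2 * c / q" by (rule form_le[OF assms(1-3)])
  also have "\<dots> \<le> c0 / q" using c_le \<kappa> assms(1) by (intro divide_right_mono) auto
  finally show ?thesis unfolding slope_def form_def
    using assms by (intro transversal) (auto simp: attached_def)
qed

text \<open>The class satisfies \<open>(R ^ t) ^ g = G ^ t\<close>, and by the lower bound on the
  slope this is at most \<open>W / \<kappa>0\<close> times a power of \<open>q\<close> with exponent
  below 2, hence at most \<open>g * s\<close>; then the \<open>g\<close>-th root is taken. It is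
  used with \<open>s = \<epsilon>\<close> and with \<open>s = j\<close>.\<close>

lemma power_class_le:
  fixes q :: int
  assumes "1 \<le> q" "\<kappa>0 * q powr (\<epsilon> - 1) \<le> slope A B" "G ^ t \<le> W * q powr i / slope A B"
    and s: "0 \<le> s" "2 \<le> real g * s"
  shows "R ^ t \<le> W / \<kappa>0 * q powr s"
proof -
  define Q where "Q = real_of_int q"
  have Q: "Q \<ge> 1" unfolding Q_def using assms(1) by simp
  have V: "1 \<le> W / \<kappa>0" using W \<kappa>0 by (simp add: le_divide_eq)
  have "(R ^ t) ^ g = G ^ t" by (simp add: G_def mult.commute flip: power_mult)
  also have "\<dots> \<le> W * Q powr i / slope A B" using assms(3) by (simp add: Q_def)
  also have "\<dots> \<le> W * Q powr i / (\<kappa>0 * Q powr (\<epsilon> - 1))"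
  proof (intro divide_left_mono)
    have "0 < \<kappa>0 * Q powr (\<epsilon> - 1)" using \<kappa>0 Q by simp
    then show "0 < slope A B * (\<kappa>0 * Q powr (\<epsilon> - 1))"
      using assms(2) unfolding Q_def[symmetric] by (metis mult_pos_pos order_less_le_trans)
  qed (use assms(2) W in \<open>auto simp: Q_def\<close>)
  also have "\<dots> = W / \<kappa>0 * Q powr (i - (\<epsilon> - 1))" using Q by (simp add: powr_diff)
  also have "\<dots> \<le> W / \<kappa>0 * Q powr (real g * s)"
    using Q V s \<epsilon> i_bounds by (intro mult_left_mono powr_mono) auto
  also have "\<dots> \<le> (W / \<kappa>0) ^ g * Q powr (real g * s)"
    using V g0 power_increasing[of 1 g "W / \<kappa>0"] by (intro mult_right_mono) auto
  also have "\<dots> = (W / \<kappa>0 * Q powr s) ^ g"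
    unfolding power_mult_distrib using Q by (simp add: powr_power)
  finally show ?thesis using g0 W \<kappa>0 unfolding Q_def[symmetric]
    by (subst (asm) power_mono_iff) (auto simp: R0 less_imp_le)
qed

text \<open>The upper bound on the slope yields a class \<open>t\<close>. The lower bound, through
  the bound on \<open>R ^ t\<close>, makes the scale \<open>y\<close> at most \<open>l\<close>,
  which yields a stage. The second conclusion says when the group is over: \<open>c1\<close> was
  chosen so that \<open>c1 * q powr (- 1 - i) \<le> y / R ^ (8 + t)\<close>.\<close>

lemma graded_exists:
  assumes "1 \<le> q" "attached q p r A B C" "near c q p r x" "\<bar>x\<bar> \<le> X"
  obtains n t where "graded n t q A B" "c1 * q powr (- 1 - i) \<le> len (n + 8 + t)"
proof -
  define Q where "Q = real_of_int q"
  define D where "D = slope A B"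
  have Q: "Q \<ge> 1" "Q > 0" unfolding Q_def using assms(1) by auto
  have D\<kappa>: "\<kappa>0 * Q powr (\<epsilon> - 1) \<le> D" unfolding D_def Q_def by (rule slope_ge[OF assms])
  have "0 < \<kappa>0 * Q powr (\<epsilon> - 1)" using \<kappa>0 Q by simp
  then have D: "D > 0" using D\<kappa> by linarith
  have DW: "D \<le> W * Q powr i" unfolding D_def Q_def by (rule slope_le[OF assms(1,2)])
  have "1 \<le> W * Q powr i / D" using D DW by simp
  then obtain t where t: "G ^ t \<le> W * Q powr i / D" "W * Q powr i / D < G ^ Suc t"
    using power_level_exists G by blast
  have Rt: "R ^ t \<le> W / \<kappa>0 * Q powr \<epsilon>"
    unfolding Q_def
    by (rule power_class_le[of q A B]) (use assms(1) D\<kappa> t \<epsilon> in \<open>auto simp: Q_def D_def\<close>)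
  define y where "y = \<kappa> * R ^ (t - t0) / (Q * D)"
  have y0: "y > 0" unfolding y_def using \<kappa> R0 Q D by simp
  have "\<kappa>0 * Q powr \<epsilon> = Q * (\<kappa>0 * Q powr (\<epsilon> - 1))"
    using Q by (simp add: powr_diff)
  also have "\<dots> \<le> Q * D" using D\<kappa> Q by (intro mult_left_mono) auto
  finally have QD: "\<kappa>0 * Q powr \<epsilon> \<le> Q * D" .
  have "\<kappa> * R ^ (t - t0) \<le> \<kappa> * R ^ t"
    using \<kappa> R0 by (intro mult_left_mono power_increasing) auto
  also have "\<dots> \<le> \<kappa> * (W / \<kappa>0 * Q powr \<epsilon>)" using Rt \<kappa> by (intro mult_left_mono) auto
  also have "\<dots> = \<kappa> * W * (Q powr \<epsilon> / \<kappa>0)" by simp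
  also have "\<dots> \<le> l * \<kappa>0\<^sup>2 * (Q powr \<epsilon> / \<kappa>0)"
    using \<kappa>(2) \<kappa>0 unfolding W_def by (intro mult_right_mono) auto
  also have "\<dots> = l * (\<kappa>0 * Q powr \<epsilon>)" using \<kappa>0 by (simp add: power2_eq_square)
  also have "\<dots> \<le> l * (Q * D)" using QD l by (intro mult_left_mono) auto
  finally have "y \<le> l" unfolding y_def using Q D by (simp add: divide_le_eq)
  then obtain n where n: "len (Suc n) < y" "y \<le> len n"
    using geometric_level_exists[OF y0 _ R0(3)] unfolding len_def by blast
  have gr: "graded n t q A B"
    using D t n unfolding graded_def D_def[symmetric] Q_def[symmetric] y_def[symmetric] by simp
  have "c1 * Q powr (- 1 - i) = \<kappa> / (R ^ (8 + t0) * (Q * (W * Q powr i)))"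
  proof -
    have "Q powr (- 1 - i) = 1 / (Q * Q powr i)"
      using Q powr_add[of Q 1 i] by (simp add: powr_minus_divide[of Q "1 + i", simplified])
    then show ?thesis unfolding c1_def by simp
  qed
  also have "\<dots> \<le> \<kappa> / (R ^ (8 + t0) * (Q * D))"
    using DW D Q W R0 \<kappa> by (intro divide_left_mono mult_left_mono mult_pos_pos) auto
  also have "\<dots> = \<kappa> * R ^ (t - t0) / (Q * D) / (R ^ (t - t0) * R ^ (8 + t0))"
    using R0 by simp
  \<comment> \<open>With truncated subtraction, \<open>t \<le> (t - t0) + t0\<close> holds in both
    cases.\<close>
  also have "\<dots> \<le> y / R ^ (8 + t)"
    unfolding y_def[symmetric] power_add[symmetric] using R0 y0
    by (intro divide_left_mono power_increasing mult_pos_pos) auto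
  also have "\<dots> \<le> len n / R ^ (8 + t)" using n R0 by (intro divide_right_mono) auto
  also have "\<dots> = len (n + 8 + t)" by (simp only: len_add[symmetric] add.assoc)
  finally show ?thesis using that[OF gr] unfolding Q_def by simp
qed

text \<open>Such a point belongs to a group of some stage \<open>k\<close> and class
  \<open>t\<close> with \<open>k + 8 + t \<le> n\<close>, so \<open>x\<close> would lie in a
  dangerous set that the ball no longer meets. This is the contradiction on which all later
  avoidance arguments rest.\<close>

lemma no_near_point:
  assumes J: "{v..v + len n} \<subseteq> {u0..u0 + l}" and x: "x \<in> {v..v + len n}"
    and dead: "\<And>k m. k + 7 + m \<le> n \<Longrightarrow> danger k m \<inter> {v..v + len n} = {}"
    and q: "1 \<le> q" and near: "near c q (of_int p) (of_int r) x"
    and small: "len n \<le> c1 * q powr (- 1 - i)"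
  shows False
proof -
  obtain A B C where att: "attached q p r A B C"
    using attached_line_exists[OF ij(3) q, of p r] unfolding attached_def by metis
  have "x \<in> {-X..X}" using x J X by blast
  then have "\<bar>x\<bar> \<le> X" by auto
  then obtain k t where kt: "graded k t q A B" "c1 * q powr (- 1 - i) \<le> len (k + 8 + t)"
    using graded_exists[OF q att near] by blast
  have "len n \<le> len (k + 8 + t)" using kt small by linarith
  then have "k + 7 + Suc t \<le> n" unfolding len_less_iff by simp
  moreover have "hit k t x q p r A B C"
    unfolding hit_def using q att near kt by simp
  then have "x \<in> danger k (Suc t)" unfolding danger_def by (simp, blast)
  ultimately show False using dead x by blast
qed

section \<open>Two points of the same group\<close>

lemma hitD:
  assumes "hit n t x q p r A B C"
  shows "1 \<le> q" "slope A B > 0" "attached q p r A B C" "near c q p r x"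
    "q * slope A B * len n \<le> \<kappa> * R ^ (t - t0) * R"
    "\<kappa> * R ^ (t - t0) \<le> len n * (q * slope A B)"
    "G ^ t * slope A B \<le> W * q powr i" "W * q powr i \<le> G * G ^ t * slope A B"
proof -
  have h: "1 \<le> q" "slope A B > 0" "attached q p r A B C" "near c q p r x"
    "G ^ t \<le> W * q powr i / slope A B" "W * q powr i / slope A B < G ^ Suc t"
    "len (Suc n) < \<kappa> * R ^ (t - t0) / (q * slope A B)"
    "\<kappa> * R ^ (t - t0) / (q * slope A B) \<le> len n"
    using assms unfolding hit_def graded_def by auto
  then show "1 \<le> q" "slope A B > 0" "attached q p r A B C" "near c q p r x" by auto
  have qD: "0 < q * slope A B" using h by simp
  show "G ^ t * slope A B \<le> W * q powr i" "W * q powr i \<le> G * G ^ t * slope A B"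
    using h(2,5,6) by (auto simp: le_divide_eq divide_less_eq)
  show "\<kappa> * R ^ (t - t0) \<le> len n * (q * slope A B)"
    using h(8) qD by (simp add: pos_divide_le_eq)
  have "len (Suc n) * (q * slope A B) < \<kappa> * R ^ (t - t0)"
    using h(7) qD by (simp add: pos_less_divide_eq)
  then have "R * (len (Suc n) * (q * slope A B)) \<le> R * (\<kappa> * R ^ (t - t0))"
    using R0 by (intro mult_left_mono) auto
  then show "q * slope A B * len n \<le> \<kappa> * R ^ (t - t0) * R"
    unfolding len_Suc[of n] by (simp add: mult_ac)
qed

text \<open>The stage fixes \<open>q D\<close> up to a factor \<open>R\<close> and the class fixes
  \<open>q powr i / D\<close> up to a factor \<open>G\<close>. Their product
  \<open>q * q powr i\<close> is thus fixed up to \<open>R * G\<close>, and the exponent is at least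
  1.\<close>

lemma hit_ratio:
  assumes "hit n t x q p r A B C" "hit n t x' q' p' r' A' B' C'"
  shows "real_of_int q' \<le> R * G * q"
proof (rule ccontr)
  assume "\<not> ?thesis"
  then have gt: "real_of_int q' > R * G * q" by simp
  note h = hitD[OF assms(1)] and h' = hitD[OF assms(2)]
  define D D' where "D = slope A B" and "D' = slope A' B'"
  have D: "D > 0" "D' > 0" using h h' unfolding D_def D'_def by auto
  have RG: "R * G \<ge> 1" using mult_mono[of 1 R 1 G] R0 G by simp
  have q: "real_of_int q > 0" "real_of_int q' > 0" using h h' by auto
  have mono3: "x * y * z \<le> x' * y' * z'" if "x \<le> x'" "y \<le> y'" "z \<le> z'" "0 \<le> x" "0 \<le> y" "0 \<le> z"
    for x y z x' y' z' :: real
    using that by (intro mult_mono) auto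
  have "q' * D' * len n \<le> \<kappa> * R ^ (t - t0) * R" using h'(5) unfolding D'_def .
  also have "\<dots> \<le> len n * (q * D) * R" using h(6) R0 unfolding D_def by (intro mult_right_mono) auto
  finally have "len n * (q' * D') \<le> len n * (R * (q * D))" by (simp add: mult_ac)
  then have 1: "q' * D' \<le> R * (q * D)" using len_pos[of n] by simp
  have "(q' * D') * (W * q' powr i) * (G ^ t * D)
      \<le> (R * (q * D)) * (G * G ^ t * D') * (W * q powr i)"
    using 1 h(7) h'(8) q D W R0 G unfolding D_def[symmetric] D'_def[symmetric]
    by (intro mono3) auto
  then have "(D * D' * W * G ^ t) * (q' * q' powr i) \<le> (D * D' * W * G ^ t) * (R * G * q * q powr i)"
    by (simp add: mult_ac)
  then have "q' * q' powr i \<le> R * G * q * q powr i"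
    using D W G by simp
  moreover have "R * G * q * q powr i < q' * q' powr i"
  proof (intro mult_less_le_imp_less)
    have "1 * real_of_int q \<le> R * G * q" using RG q by (intro mult_right_mono) auto
    then have "real_of_int q \<le> q'" using gt by linarith
    then show "q powr i \<le> q' powr i" using q i_bounds by (intro powr_mono2) auto
  qed (use gt q RG G R0 in auto)
  ultimately show False by simp
qed

text \<open>The form is at most \<open>2 * c / q\<close> at \<open>x\<close> and changes by at most
  \<open>slope A B * len n\<close> on the ball; the stage bounds the latter.\<close>

lemma hit_form_le:
  assumes "hit n t x q p r A B C" "\<bar>x - y\<bar> \<le> len n"
  shows "\<bar>form A B C y\<bar> \<le> 2 * \<kappa> * R ^ (t - t0) * R / q"
proof -
  note h = hitD[OF assms(1)]
  have q: "real_of_int q > 0" using h by simp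
  have 1: "1 \<le> R ^ (t - t0) * R"
    using mult_mono[of 1 "R ^ (t - t0)" 1 R] R0 by simp
  have "\<kappa> * 1 \<le> \<kappa> * (R ^ (t - t0) * R)" using 1 \<kappa> by (intro mult_left_mono) auto
  then have "2 * c \<le> \<kappa> * (R ^ (t - t0) * R)" using c_le \<kappa> by linarith
  have "\<bar>form A B C y\<bar> \<le> \<bar>form A B C x\<bar> + \<bar>form A B C x - form A B C y\<bar>" by linarith
  also have "\<dots> \<le> 2 * c / q + slope A B * len n"
    unfolding form_diff using form_le[OF h(1,3,4)] assms(2) slope_nonneg
    by (intro add_mono mult_left_mono) auto
  also have "\<dots> = (2 * c + q * slope A B * len n) / q" using q by (simp add: field_simps)
  also have "\<dots> \<le> (\<kappa> * (R ^ (t - t0) * R) + \<kappa> * R ^ (t - t0) * R) / q"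
    using h(5) q \<open>2 * c \<le> \<kappa> * (R ^ (t - t0) * R)\<close> by (intro divide_right_mono add_mono) auto
  also have "\<dots> = 2 * \<kappa> * R ^ (t - t0) * R / q" by (simp add: mult_ac)
  finally show ?thesis .
qed

lemma hit_radius_le:
  assumes "hit n t x q p r A B C"
  shows "c / (q * slope A B) \<le> len (n + 8 + t) / (4 * W)"
proof -
  note h = hitD[OF assms(1)]
  have q: "real_of_int q > 0" using h by simp
  have "c * (R ^ (8 + t) * (4 * W)) \<le> c * (R ^ (8 + t0) * R ^ (t - t0) * (4 * W))"
    unfolding power_add[symmetric] using c_pos W R0
    by (intro mult_left_mono mult_right_mono power_increasing) auto
  also have "\<dots> = \<kappa> * R ^ (t - t0)"
    unfolding c_def c1_def using W R0 by (simp add: field_simps)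
  also have "\<dots> \<le> len n * (q * slope A B)" by (rule h)
  finally have "c / (q * slope A B) \<le> len n / R ^ (8 + t) / (4 * W)"
    using q h(2) R0 W by (simp add: field_simps)
  then show ?thesis by (simp only: len_add[symmetric] add.assoc)
qed

text \<open>Proportional coefficients give both forms the same zero \<open>- e / d\<close>, and each
  of \<open>x\<close>, \<open>x'\<close> is within half the claimed distance of it.\<close>

lemma close_of_parallel:
  assumes "hit n t x q p r A B C" "hit n t x' q' p' r' A' B' C'"
    and "A * B' = A' * B" "A * C' = A' * C" "B * C' = B' * C"
  shows "\<bar>x - x'\<bar> \<le> len (n + 8 + t)"
proof -
  define d e d' e' where "d = of_int A + a * of_int B" and "e = of_int B * b + of_int C"
    and "d' = of_int A' + a * of_int B'" and "e' = of_int B' * b + of_int C'"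
  have nz: "d \<noteq> 0" "d' \<noteq> 0"
    using hitD(2)[OF assms(1)] hitD(2)[OF assms(2)] unfolding d_def d'_def slope_def by auto
  have "real_of_int A * of_int B' = of_int A' * of_int B"
       "real_of_int A * of_int C' = of_int A' * of_int C"
       "real_of_int B * of_int C' = of_int B' * of_int C"
    using assms(3-5) by (simp_all flip: of_int_mult)
  then have "d * e' = d' * e" unfolding d_def d'_def e_def e'_def by algebra
  then have eq: "e / d = e' / d'" using nz by (simp add: field_simps)
  have near: "\<bar>x + e / d\<bar> \<le> len (n + 8 + t) / 2" if hit: "hit n t x q p r A B C"
    and d: "d = of_int A + a * of_int B" "e = of_int B * b + of_int C" for x q p r A B C d e
  proof -
    note h = hitD[OF hit]
    have d0: "d \<noteq> 0" "\<bar>d\<bar> = slope A B" using h(2) d unfolding slope_def by auto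
    have "form A B C x = d * x + e" by (simp add: form_def d algebra_simps)
    then have "form A B C x = d * (x + e / d)" using d0 by (simp add: distrib_left)
    then have "\<bar>form A B C x\<bar> = slope A B * \<bar>x + e / d\<bar>" by (simp add: abs_mult d0)
    then have "slope A B * \<bar>x + e / d\<bar> \<le> 2 * c / q" using form_le[OF h(1,3,4)] by simp
    then have "\<bar>x + e / d\<bar> \<le> 2 * (c / (q * slope A B))" using h(1,2) by (simp add: field_simps)
    also have "\<dots> \<le> 2 * (len (n + 8 + t) / (4 * W))" using hit_radius_le[OF hit] by simp
    also have "\<dots> \<le> len (n + 8 + t) / 2"
      using W len_pos[of "n + 8 + t"] by (simp add: field_simps)
    finally show ?thesis .
  qed
  show ?thesis
    using near[OF assms(1) d_def e_def] near[OF assms(2) d'_def e'_def] eq by linarith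
qed

text \<open>Both points have the same \<open>p / q\<close>, and
  \<open>q powr (- i) \<le> W / slope A B\<close> makes each of \<open>x\<close>, \<open>x'\<close>
  close to it.\<close>

lemma close_of_same_abscissa:
  assumes "hit n t x q p r A B C" "hit n t x' q' p' r' A' B' C'" and "p * q' = p' * q"
  shows "\<bar>x - x'\<bar> \<le> len (n + 8 + t)"
proof -
  have near: "\<bar>x - p / q\<bar> \<le> len (n + 8 + t) / 4" if hit: "hit n t x q p r A B C" for x q p r A B C
  proof -
    note h = hitD[OF hit]
    have q: "real_of_int q > 0" using h by simp
    have "q powr (- i) * slope A B \<le> q powr (- i) * (W * q powr i)"
      using slope_le[OF h(1,3)] by (intro mult_left_mono) auto
    also have "\<dots> = W" using q by (simp add: powr_minus)
    finally have W': "q powr (- i) \<le> W / slope A B" using h(2) by (simp add: field_simps)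
    have "q * \<bar>x - p / q\<bar> = \<bar>q * x - p\<bar>"
      using q by (simp add: abs_mult_pos' field_simps flip: abs_mult)
    also have "\<dots> \<le> c * q powr (- i)" using h(4) unfolding near_def by simp
    also have "\<dots> \<le> c * (W / slope A B)" using W' c_pos by (intro mult_left_mono) auto
    finally have "\<bar>x - p / q\<bar> \<le> W * (c / (q * slope A B))" using q h(2) by (simp add: field_simps)
    also have "\<dots> \<le> W * (len (n + 8 + t) / (4 * W))"
      using hit_radius_le[OF hit] W by (intro mult_left_mono) auto
    also have "\<dots> = len (n + 8 + t) / 4" using W by simp
    finally show ?thesis .
  qed
  have "real_of_int p * q' = p' * q" using assms(3) by (simp flip: of_int_mult)
  then have "real_of_int p / q = p' / q'"
    using hitD(1)[OF assms(1)] hitD(1)[OF assms(2)] by (simp add: field_simps)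
  then show ?thesis
    using near[OF assms(1)] near[OF assms(2)] len_pos[of "n + 8 + t"] by linarith
qed

text \<open>Each of the two lines, evaluated at the other point, gives an integer of modulus less than 1.\<close>

lemma close_of_low_class:
  assumes "hit n t x q p r A B C" "hit n t x' q' p' r' A' B' C'"
    and "\<bar>x - x'\<bar> \<le> len n" "t \<le> t0"
  shows "\<bar>x - x'\<bar> \<le> len (n + 8 + t)"
proof -
  have vanish: "A * p' + B * r' + C * q' = 0"
    if hit: "hit n t x q p r A B C" "hit n t x' q' p' r' A' B' C'" and d: "\<bar>x - x'\<bar> \<le> len n"
    for x q p r A B C x' q' p' r' A' B' C'
  proof -
    note h = hitD[OF hit(1)] and h' = hitD[OF hit(2)]
    have q: "real_of_int q > 0" "real_of_int q' > 0" using h h' by auto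
    have RG: "R * G \<ge> 1" using mult_mono[of 1 R 1 G] R0 G by simp
    have F: "\<bar>form A B C x'\<bar> \<le> 2 * \<kappa> * R / q"
      using hit_form_le[OF hit(1) d] \<open>t \<le> t0\<close> by simp
    have "q' * \<bar>form A B C x'\<bar> \<le> (R * G * q) * (2 * \<kappa> * R / q)"
      using F hit_ratio[OF hit] q \<kappa> R0 G by (intro mult_mono) auto
    also have "\<dots> = 2 * \<kappa> * R\<^sup>2 * G" using q by (simp add: power2_eq_square)
    finally have 1: "q' * \<bar>form A B C x'\<bar> \<le> 2 * \<kappa> * R\<^sup>2 * G" .
    \<comment> \<open>The heights differ at most by the factor \<open>R * G\<close>, so the powers
      of \<open>q\<close> and \<open>q'\<close> cancel up to that factor.\<close>
    have part: "u * v \<le> c * (R * G)" if "0 \<le> u" "u \<le> q powr s" "0 \<le> v" "v \<le> c * q' powr (- s)" "0 \<le> s" "s \<le> 1"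
      for u v s :: real
    proof -
      have "u * v \<le> q powr s * (c * q' powr (- s))" using that by (intro mult_mono) auto
      also have "q powr s \<le> R * G * q' powr s"
        using hit_ratio[OF hit(2,1)] q RG that by (intro powr_le_mult_powr) auto
      also have "R * G * q' powr s * (c * q' powr (- s)) = c * (R * G)"
        using q by (simp add: powr_minus)
      finally show ?thesis using c_pos by (simp add: mult_right_mono)
    qed
    have 2: "\<bar>real_of_int A\<bar> * \<bar>q' * x' - p'\<bar> \<le> c * (R * G)"
      using h(3) h'(4) i_bounds unfolding attached_def near_def by (intro part[of _ i]) auto
    have 3: "\<bar>real_of_int B\<bar> * \<bar>q' * (a * x' + b) - r'\<bar> \<le> c * (R * G)"
      using h(3) h'(4) i_bounds ij unfolding attached_def near_def by (intro part[of _ j]) auto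
    have "real_of_int (A * p' + B * r' + C * q')
        = q' * form A B C x' - A * (q' * x' - p') - B * (q' * (a * x' + b) - r')"
      unfolding form_def by (simp add: algebra_simps)
    then have "\<bar>real_of_int (A * p' + B * r' + C * q')\<bar>
        \<le> \<bar>q' * form A B C x'\<bar> + \<bar>A * (q' * x' - p')\<bar> + \<bar>B * (q' * (a * x' + b) - r')\<bar>"
      by linarith
    also have "\<dots> \<le> 2 * \<kappa> * R\<^sup>2 * G + c * (R * G) + c * (R * G)"
      using 1 2 3 q unfolding abs_mult by (intro add_mono) auto
    also have "\<dots> \<le> 2 * \<kappa> * R\<^sup>2 * G + \<kappa> * (R\<^sup>2 * G) + \<kappa> * (R\<^sup>2 * G)"
    proof -
      have "R * G \<le> R\<^sup>2 * G" using R0 G unfolding power2_eq_square by simp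
      then have "c * (R * G) \<le> \<kappa> * (R\<^sup>2 * G)"
        using c_le c_pos \<kappa> R0 G by (intro mult_mono) auto
      then show ?thesis by linarith
    qed
    also have "\<dots> = \<kappa> * (8 * R\<^sup>2 * G) / 2" by simp
    also have "\<dots> < 1"
    proof -
      have "\<kappa> * (8 * R\<^sup>2 * G * 1) \<le> \<kappa> * (8 * R\<^sup>2 * G * W)"
        using \<kappa> R0 G W by (intro mult_left_mono) auto
      then show ?thesis using \<kappa>(3) \<kappa>0 unfolding W_def G_def by linarith
    qed
    finally show ?thesis by linarith
  qed
  have v: "A * p + B * r + C * q = 0" "A' * p' + B' * r' + C' * q' = 0"
    "A * p' + B * r' + C * q' = 0" "A' * p + B' * r + C' * q = 0"
    using hitD(3)[OF assms(1)] hitD(3)[OF assms(2)] vanish[OF assms(1,2,3)]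
      vanish[OF assms(2,1)] assms(3) unfolding attached_def by (auto simp: abs_minus_commute)
  have q: "q \<noteq> 0" using hitD(1)[OF assms(1)] by simp
  show ?thesis
  proof (cases "p * q' = p' * q")
    case True
    then show ?thesis by (rule close_of_same_abscissa[OF assms(1,2)])
  next
    case False
    \<comment> \<open>Both lines pass through both rational points. As the abscissas differ, the
      lines coincide.\<close>
    have "(A * B' - A' * B) * (p * q' - p' * q) = 0" using v by algebra
    then have AB: "A * B' = A' * B" using False by simp
    have "q * (A * C' - A' * C) = 0" using v AB by algebra
    moreover have "q * (B * C' - B' * C) = 0" using v AB by algebra
    ultimately show ?thesis using q AB by (intro close_of_parallel[OF assms(1,2)]) auto
  qed
qed

text \<open>Of the three factors \<open>R ^ t\<close>, one stays and the other two are at least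
  \<open>R ^ t0\<close> each: one for the \<open>R ^ t0\<close> on the left, one for the
  constants.\<close>

lemma class_constants:
  assumes "t0 < t"
  shows "64 * W ^ 4 * R ^ 12 * G ^ 3 * R ^ t0 * R ^ t \<le> R ^ (3 * t)"
proof -
  have "G ^ 3 = R ^ (3 * g)" unfolding G_def by (simp add: mult.commute flip: power_mult)
  then have "64 * W ^ 4 * R ^ 12 * G ^ 3 = W ^ 4 * 64 * R ^ (12 + 3 * g)"
    by (simp add: power_add)
  also have "\<dots> \<le> R ^ t0" using t0 unfolding W_def .
  finally have "64 * W ^ 4 * R ^ 12 * G ^ 3 * R ^ t0 * R ^ t \<le> R ^ t0 * R ^ t0 * R ^ t"
    using R0 by (intro mult_right_mono) auto
  also have "\<dots> = R ^ (t0 + t0 + t)" by (simp add: power_add)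
  also have "\<dots> \<le> R ^ (3 * t)" using R0 assms by (intro power_increasing) auto
  finally show ?thesis .
qed

text \<open>The cross product of the two lines is a rational point of smaller height that is near \<open>x\<close>.\<close>

lemma close_of_high_class:
  assumes hits: "hit n t x q p r A B C" "hit n t x' q' p' r' A' B' C'"
    and J: "{v..v + len n} \<subseteq> {u0..u0 + l}" and x: "x \<in> {v..v + len n}" "x' \<in> {v..v + len n}"
    and dead: "\<And>k m. k + 7 + m \<le> n \<Longrightarrow> danger k m \<inter> {v..v + len n} = {}"
    and t: "t0 < t"
  shows "\<bar>x - x'\<bar> \<le> len (n + 8 + t)"
proof (rule ccontr)
  assume far: "\<not> ?thesis"
  note h = hitD[OF hits(1)] and h' = hitD[OF hits(2)]
  define Q Q' where "Q = real_of_int q" and "Q' = real_of_int q'"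
  define D D' where "D = slope A B" and "D' = slope A' B'"
  define F F' where "F = form A B C x" and "F' = form A' B' C' x"
  \<comment> \<open>The cross product of the coefficient vectors: the intersection point of the
    lines in homogeneous coordinates.\<close>
  define p0 r0 q0 where "p0 = B * C' - B' * C" and "r0 = A' * C - A * C'" and "q0 = A * B' - A' * B"
  \<comment> \<open>\<open>N\<close> bounds the ratio of the heights, \<open>K\<close> bounds height
    times form at \<open>x\<close>, and \<open>M\<close> bounds the combinations of the two forms in
    \<open>cross\<close>.\<close>
  define N K M where "N = R * G" and "K = 2 * \<kappa> * R ^ t * R" and "M = 2 * N * K"
  define C1 where "C1 = 2 * W * N"
  have Q: "Q \<ge> 1" "Q' \<ge> 1" "Q > 0" "Q' > 0" using h h' unfolding Q_def Q'_def by auto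
  have N: "N \<ge> 1" unfolding N_def using mult_mono[of 1 R 1 G] R0 G by simp
  have K: "K > 0" unfolding K_def using \<kappa> R0 by simp
  have C1: "C1 \<ge> 1" unfolding C1_def using mult_mono[of 1 W 1 N] W N by simp
  have ratio: "Q' \<le> N * Q" "Q \<le> N * Q'"
    using hit_ratio[OF hits] hit_ratio[OF hits(2,1)] unfolding N_def Q_def Q'_def by auto
  have s01: "0 \<le> i" "i \<le> 1" "0 \<le> j" "j \<le> 1" using ij i_bounds by auto
  have K': "2 * \<kappa> * R ^ (t - t0) * R \<le> K" unfolding K_def using \<kappa> R0
    by (intro mult_right_mono mult_left_mono power_increasing) auto
  have "\<bar>F\<bar> \<le> 2 * \<kappa> * R ^ (t - t0) * R / Q"
    unfolding F_def Q_def using len_pos[of n] by (intro hit_form_le[OF hits(1)]) simp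
  also have "\<dots> \<le> K / Q" using K' Q by (intro divide_right_mono) auto
  finally have F: "\<bar>F\<bar> \<le> K / Q" .
  have "\<bar>F'\<bar> \<le> 2 * \<kappa> * R ^ (t - t0) * R / Q'"
    unfolding F'_def Q'_def using x by (intro hit_form_le[OF hits(2)]) auto
  also have "\<dots> \<le> K / Q'" using K' Q by (intro divide_right_mono) auto
  finally have F': "\<bar>F'\<bar> \<le> K / Q'" .
  have cross: "\<bar>u * F' - u' * F\<bar> \<le> M * Q powr (s - 1)"
    if u: "\<bar>u\<bar> \<le> Q powr s" "\<bar>u'\<bar> \<le> Q' powr s" and s: "0 \<le> s" "s \<le> 1" for u u' s :: real
  proof -
    have "\<bar>u * F' - u' * F\<bar> \<le> \<bar>u\<bar> * \<bar>F'\<bar> + \<bar>u'\<bar> * \<bar>F\<bar>" by (simp flip: abs_mult)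
    also have "\<dots> \<le> Q powr s * (K * (N / Q)) + (N * Q powr s) * (K / Q)"
    proof (intro add_mono mult_mono)
      have "1 / Q' \<le> N / Q" using ratio Q by (simp add: field_simps)
      then have "K / Q' \<le> K * (N / Q)" using mult_left_mono[of "1 / Q'" "N / Q" K] K by simp
      then show "\<bar>F'\<bar> \<le> K * (N / Q)" using F' by linarith
      show "\<bar>u'\<bar> \<le> N * Q powr s"
        using powr_le_mult_powr[OF Q(3,4) ratio(1) N s] u(2) by linarith
    qed (use u F N Q in auto)
    also have "\<dots> = M * Q powr (s - 1)" using Q by (simp add: M_def powr_diff)
    finally show ?thesis .
  qed
  have P: "p0 - q0 * x = B * F' - B' * F"
    unfolding p0_def q0_def F_def F'_def form_def by (simp add: algebra_simps)
  have Pr: "r0 - q0 * (a * x + b) = - (A * F' - A' * F)"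
    unfolding r0_def q0_def F_def F'_def form_def by (simp add: algebra_simps)
  have exponents: "j - 1 = - i" "i - 1 = - j" using ij by auto
  have dp: "\<bar>p0 - q0 * x\<bar> \<le> M * Q powr (- i)"
    using cross[where u = B and u' = B' and s = j] h(3) h'(3) s01
    unfolding P exponents attached_def Q_def Q'_def by simp
  have dr: "\<bar>r0 - q0 * (a * x + b)\<bar> \<le> M * Q powr (- j)"
    using cross[where u = A and u' = A' and s = i] h(3) h'(3) s01
    unfolding Pr abs_minus exponents attached_def Q_def Q'_def by simp
  have "x \<in> {-X..X}" using x J X by blast
  then have xX: "\<bar>x\<bar> \<le> X" by auto
  have D: "D > 0" "D' > 0" using h(2) h'(2) unfolding D_def D'_def by auto
  \<comment> \<open>The class grows at most like \<open>q powr j\<close>, which cancels the factor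
    \<open>R ^ t\<close> in \<open>M\<close>. For parallel lines this makes the integers
    \<open>p0\<close> and \<open>r0\<close> vanish.\<close>
  have small: "M * Q powr (- j) < 1"
  proof -
    have "R ^ t \<le> W / \<kappa>0 * Q powr j" unfolding Q_def
      by (rule power_class_le[OF h(1) slope_ge[OF h(1,3,4) xX]])
         (use h(2,7) s01 gj in \<open>auto simp: le_divide_eq\<close>)
    then have "R ^ t * Q powr (- j) \<le> W / \<kappa>0 * Q powr j * Q powr (- j)"
      by (intro mult_right_mono) auto
    also have "\<dots> = W / \<kappa>0" using Q by (simp add: powr_minus)
    finally have 1: "R ^ t * Q powr (- j) \<le> W / \<kappa>0" .
    have "M * Q powr (- j) = 4 * \<kappa> * R\<^sup>2 * G * (R ^ t * Q powr (- j))"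
      unfolding M_def K_def N_def by (simp add: power2_eq_square)
    also have "\<dots> \<le> 4 * \<kappa> * R\<^sup>2 * G * (W / \<kappa>0)"
      using 1 \<kappa> R0 G by (intro mult_left_mono) auto
    also have "\<dots> < 1"
    proof -
      have "\<kappa> * (8 * R\<^sup>2 * G * W) \<le> \<kappa>0" using \<kappa>(3) unfolding W_def G_def .
      then have "4 * \<kappa> * R\<^sup>2 * G * W < \<kappa>0" using \<kappa>0 by simp
      then show ?thesis using \<kappa>0 by (simp add: divide_less_eq)
    qed
    finally show ?thesis .
  qed
  show False
  proof (cases "q0 = 0")
    case True
    have "Q powr (- i) \<le> Q powr (- j)" using Q ij by (intro powr_mono) auto
    then have "M * Q powr (- i) \<le> M * Q powr (- j)"
      using N K unfolding M_def by (intro mult_left_mono) auto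
    then have "\<bar>real_of_int p0\<bar> < 1" "\<bar>real_of_int r0\<bar> < 1" using dp dr small True by auto
    then have "p0 = 0" "r0 = 0" by linarith+
    then show False using close_of_parallel[OF hits] far True
      unfolding p0_def q0_def r0_def by simp
  next
    case False
    define Q0 where "Q0 = real_of_int \<bar>q0\<bar>"
    have Q0: "Q0 \<ge> 1" unfolding Q0_def using False by linarith
    \<comment> \<open>The determinant equals \<open>d * B' - d' * B\<close>, and the class bounds
      both slopes by a multiple of \<open>q powr i / G ^ t\<close>; hence the height drops by about
      \<open>G ^ t\<close>.\<close>
    have q0_le: "Q0 \<le> C1 / G ^ t * Q"
    proof -
      define d d' where "d = of_int A + a * of_int B" and "d' = of_int A' + a * of_int B'"
      have "real_of_int q0 = d * B' - d' * B"
        unfolding q0_def d_def d'_def by (simp add: algebra_simps)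
      then have "Q0 \<le> D * \<bar>real_of_int B'\<bar> + D' * \<bar>real_of_int B\<bar>"
        unfolding Q0_def D_def D'_def slope_def d_def[symmetric] d'_def[symmetric]
        by (simp flip: abs_mult)
      also have "\<dots> \<le> (W * Q powr i / G ^ t) * (N * Q powr j) + (W * (N * Q powr i) / G ^ t) * Q powr j"
      proof (intro add_mono mult_mono)
        show "D \<le> W * Q powr i / G ^ t" using h(7) G unfolding D_def Q_def by (simp add: field_simps)
        show "\<bar>real_of_int B'\<bar> \<le> N * Q powr j"
          using powr_le_mult_powr[OF Q(3,4) ratio(1) N s01(3,4)] h'(3) unfolding attached_def Q'_def by linarith
        have "D' \<le> W * Q' powr i / G ^ t" using h'(7) G unfolding D'_def Q'_def by (simp add: field_simps)
        also have "\<dots> \<le> W * (N * Q powr i) / G ^ t"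
          using powr_le_mult_powr[OF Q(3,4) ratio(1) N s01(1,2)] W G
          by (intro divide_right_mono mult_left_mono) auto
        finally show "D' \<le> W * (N * Q powr i) / G ^ t" .
        show "\<bar>real_of_int B\<bar> \<le> Q powr j" using h(3) unfolding attached_def Q_def by simp
      qed (use W G N in auto)
      also have "\<dots> = C1 / G ^ t * (Q powr i * Q powr j)" unfolding C1_def by (simp add: field_simps)
      also have "Q powr i * Q powr j = Q" using Q ij by (simp flip: powr_add)
      finally show ?thesis .
    qed
    \<comment> \<open>Even the smallest exponent \<open>s = j\<close> retains the gain
      \<open>R ^ (3 * t)\<close>.\<close>
    have pw: "Q0 powr s \<le> C1 / R ^ (3 * t) * Q powr s" if s: "j \<le> s" "s \<le> 1" for s
    proof -
      have "Q0 powr s \<le> (C1 / G ^ t * Q) powr s"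
        using q0_le Q0 s ij by (intro powr_mono2) auto
      also have "\<dots> = C1 powr s / (G ^ t) powr s * Q powr s"
        using C1 G Q by (simp add: powr_mult powr_divide)
      also have "\<dots> \<le> C1 / R ^ (3 * t) * Q powr s"
      proof (intro mult_right_mono frac_le)
        show "C1 powr s \<le> C1" using C1 s powr_mono[of s 1 C1] by simp
        have "R ^ (3 * t) = R powr (real t * 3)" using R0 by (simp add: powr_realpow[symmetric] mult.commute)
        also have "\<dots> \<le> R powr (real t * (real g * s))"
        proof (intro powr_mono mult_left_mono)
          have "real g * j \<le> real g * s" using s by (intro mult_left_mono) auto
          then show "3 \<le> real g * s" using gj by linarith
        qed (use R0 in auto)
        also have "\<dots> = (G ^ t) powr s"
        proof -
          have "G ^ t = R powr (real g * real t)"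
            unfolding G_def using R0 by (simp add: powr_realpow[symmetric] powr_powr)
          then show ?thesis by (simp add: powr_powr mult_ac)
        qed
        finally show "R ^ (3 * t) \<le> (G ^ t) powr s" .
      qed (use R0 C1 in auto)
      finally show ?thesis .
    qed
    note cc = class_constants[OF t]
    have R3: "R ^ (3 * t) > 0" using R0 by simp
    have MC: "M * (C1 / R ^ (3 * t)) \<le> c"
    proof -
      have "M * C1 * (4 * W * R ^ (8 + t0)) = \<kappa> * (32 * W ^ 2 * R ^ 11 * G ^ 2 * R ^ t0 * R ^ t)"
        unfolding M_def C1_def K_def N_def power_add by (simp add: eval_nat_numeral)
      also have "\<dots> \<le> \<kappa> * (64 * W ^ 4 * R ^ 12 * G ^ 3 * R ^ t0 * R ^ t)"
        using \<kappa> W R0 G by (intro mult_left_mono mult_mono power_increasing) auto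
      also have "\<dots> \<le> \<kappa> * R ^ (3 * t)" using cc \<kappa> by (intro mult_left_mono) auto
      finally have "M * C1 / R ^ (3 * t) \<le> \<kappa> / (4 * W * R ^ (8 + t0))"
        using R3 W R0 by (simp add: pos_divide_le_eq pos_le_divide_eq field_simps)
      then show ?thesis unfolding c_def c1_def by simp
    qed
    have close: "M * Q powr (- s) \<le> c * Q0 powr (- s)" if s: "j \<le> s" "s \<le> 1" for s
    proof -
      have "M * Q0 powr s \<le> M * (C1 / R ^ (3 * t) * Q powr s)"
        using pw[OF s] N K unfolding M_def by (intro mult_left_mono) auto
      also have "\<dots> = M * (C1 / R ^ (3 * t)) * Q powr s" by simp
      also have "\<dots> \<le> c * Q powr s" using MC by (intro mult_right_mono) auto
      finally show ?thesis using Q Q0 by (simp add: powr_minus field_simps)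
    qed
    \<comment> \<open>The determinant may be negative; multiplying by its sign makes the denominator
      positive.\<close>
    have near: "near c \<bar>q0\<bar> (of_int (sgn q0 * p0)) (of_int (sgn q0 * r0)) x"
    proof -
      have sg: "\<bar>real_of_int \<bar>q0\<bar> * z - of_int (sgn q0 * w)\<bar> = \<bar>of_int w - of_int q0 * z\<bar>" for z w
        by (cases "q0 > 0") (use False in \<open>auto simp: sgn_if abs_minus_commute\<close>)
      show ?thesis unfolding near_def sg
        using dp dr close[of i] close[of j] s01 ij unfolding Q0_def by auto
    qed
    \<comment> \<open>The gain \<open>G ^ t\<close> in the factor \<open>Q0\<close> cancels the
      \<open>G ^ t\<close> coming from the class of the original point; the gain
      \<open>R ^ (3 * t)\<close> in \<open>Q0 powr i\<close> pays for \<open>K\<close> and the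
      constants.\<close>
    have "len n * (Q0 * Q0 powr i) \<le> c1"
    proof -
      have "len n * (Q * D) \<le> K / 2" using h(5) K' unfolding D_def Q_def by (simp add: mult_ac)
      moreover have "W * Q powr i \<le> G * G ^ t * D" using h(8) unfolding Q_def D_def .
      ultimately have "len n * (Q * D) * (W * Q powr i) \<le> K / 2 * (G * G ^ t * D)"
        by (rule mult_mono) (use W K in auto)
      then have 1: "len n * (Q * (W * Q powr i)) \<le> K / 2 * (G * G ^ t)"
        using D by (simp add: mult_ac)
      have "len n * (Q0 * Q0 powr i) \<le> len n * ((C1 / G ^ t * Q) * (C1 / R ^ (3 * t) * Q powr i))"
        using q0_le pw[of i] ij s01 len_pos[of n] Q0
        by (intro mult_left_mono mult_mono) auto
      also have "\<dots> = len n * (Q * (W * Q powr i)) * (C1 * C1 / (W * G ^ t * R ^ (3 * t)))"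
        using W by simp
      also have "\<dots> \<le> K / 2 * (G * G ^ t) * (C1 * C1 / (W * G ^ t * R ^ (3 * t)))"
        using 1 W C1 G R0 by (intro mult_right_mono) auto
      also have "\<dots> = K / 2 * G * C1 * C1 / W / R ^ (3 * t)" using G by simp
      also have "\<dots> \<le> c1"
      proof -
        have "K / 2 * G * C1 * C1 / W * (W * R ^ (8 + t0)) = \<kappa> * (4 * W ^ 2 * R ^ 11 * G ^ 3 * R ^ t0 * R ^ t)"
          unfolding C1_def K_def N_def power_add using W by (simp add: eval_nat_numeral)
        also have "\<dots> \<le> \<kappa> * (64 * W ^ 4 * R ^ 12 * G ^ 3 * R ^ t0 * R ^ t)"
          using \<kappa> W R0 G by (intro mult_left_mono mult_mono power_increasing) auto
        also have "\<dots> \<le> \<kappa> * R ^ (3 * t)" using cc \<kappa> by (intro mult_left_mono) auto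
        finally show ?thesis
          unfolding c1_def using R3 W R0 by (simp add: pos_divide_le_eq pos_le_divide_eq field_simps)
      qed
      finally show ?thesis .
    qed
    moreover have "Q0 powr (- 1 - i) = 1 / (Q0 * Q0 powr i)"
      using Q0 powr_add[of Q0 1 i] by (simp add: powr_minus_divide[of Q0 "1 + i", simplified])
    ultimately have "len n \<le> c1 * Q0 powr (- 1 - i)" using Q0 by (simp add: le_divide_eq)
    moreover have "1 \<le> \<bar>q0\<bar>" using False by linarith
    ultimately show False
      using no_near_point[OF J x(1) dead _ near] unfolding Q0_def by simp
  qed
qed

section \<open>Inhomogeneous points\<close>

lemma shift_constants: "\<kappa>' * (R ^ 3 * (2 + \<bar>a\<bar>)) = c" "2 * c' * R ^ 7 = \<kappa>'" "c' \<le> \<kappa>'"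
    "\<kappa>' \<le> c" "c \<le> l" "c \<le> 1/4"
proof -
  show "\<kappa>' * (R ^ 3 * (2 + \<bar>a\<bar>)) = c" "2 * c' * R ^ 7 = \<kappa>'"
    unfolding \<kappa>'_def c'_def using R0 by auto
  have "1 * 1 \<le> R ^ 3 * (2 + \<bar>a\<bar>)" using R0 by (intro mult_mono one_le_power) auto
  then have "\<kappa>' * 1 \<le> \<kappa>' * (R ^ 3 * (2 + \<bar>a\<bar>))" using c_pos by (intro mult_left_mono) auto
  then show "\<kappa>' \<le> c" using \<open>\<kappa>' * (R ^ 3 * (2 + \<bar>a\<bar>)) = c\<close> by simp
  have "1 \<le> R ^ 7" using R0 by (intro one_le_power) auto
  then have "c' * 1 \<le> c' * (2 * R ^ 7)" using c_pos by (intro mult_left_mono) auto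
  then show "c' \<le> \<kappa>'" using \<open>2 * c' * R ^ 7 = \<kappa>'\<close> by (simp add: mult_ac)
  have "\<kappa>0\<^sup>2 \<le> 1" using \<kappa>0 by (simp add: power_le_one)
  then have "l * \<kappa>0\<^sup>2 \<le> l * 1" using l by (intro mult_left_mono) auto
  moreover have "\<kappa> * 1 \<le> \<kappa> * (1 + \<bar>a\<bar>)" using \<kappa> by (intro mult_left_mono) auto
  ultimately have "\<kappa> \<le> l" using \<kappa>(2) by linarith
  then show "c \<le> l" using c_le \<kappa> by linarith
  have "1 * 1 * 1 * 1 \<le> 8 * R\<^sup>2 * R ^ g * (1 + \<bar>a\<bar>)"
    using R0 by (intro mult_mono one_le_power) auto
  then have "\<kappa> * 1 \<le> \<kappa> * (8 * R\<^sup>2 * R ^ g * (1 + \<bar>a\<bar>))" using \<kappa> by (intro mult_left_mono) auto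
  then show "c \<le> 1/4" using \<kappa>(3) \<kappa>0 c_le by linarith
qed

text \<open>In the difference of the two points the shift cancels. If the heights differ, the
  difference is a homogeneous point near \<open>x'\<close> with constant \<open>c\<close>, which
  \<open>no_near_point\<close> excludes. If they agree, the numerators \<open>p\<close> and
  \<open>p'\<close> agree as well, and the radius \<open>c'\<close> bounds the distance.\<close>

lemma close_of_shifted:
  assumes q: "1 \<le> q" "q \<le> q'"
    and near: "near c' q (of_int p + \<gamma>) (of_int r + \<delta>) x" "near c' q' (of_int p' + \<gamma>) (of_int r' + \<delta>) x'"
    and lens: "len (Suc n) < \<kappa>' * q powr (- 1 - i)" "\<kappa>' * q powr (- 1 - i) \<le> len n"
      "len (Suc n) < \<kappa>' * q' powr (- 1 - i)" "\<kappa>' * q' powr (- 1 - i) \<le> len n"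
    and J: "{v..v + len n} \<subseteq> {u0..u0 + l}" and x: "x \<in> {v..v + len n}" "x' \<in> {v..v + len n}"
    and dead: "\<And>k m. k + 7 + m \<le> n \<Longrightarrow> danger k m \<inter> {v..v + len n} = {}"
  shows "\<bar>x - x'\<bar> \<le> len (n + 7)"
proof -
  define Q Q' where "Q = real_of_int q" and "Q' = real_of_int q'"
  have Q: "Q \<ge> 1" "Q > 0" "Q' \<ge> 1" "Q' > 0" "Q \<le> Q'" using q unfolding Q_def Q'_def by auto
  have dx: "\<bar>x - x'\<bar> \<le> len n" using x by auto
  have pow: "z powr (- 1 - i) = z powr (- i) / z" if "z > 0" for z :: real
  proof -
    have "- 1 - i = - i - 1" by simp
    then show ?thesis using that powr_diff[of z "- i" 1] by (simp only: powr_one_gt_zero_iff powr_one)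
  qed
  note cs = shift_constants
  have lenQ: "Q * len n \<le> R * \<kappa>' * Q powr (- i)"
  proof -
    have "len n \<le> R * (\<kappa>' * Q powr (- 1 - i))"
      unfolding len_Suc[of n] Q_def using lens(1) R0 by (intro mult_left_mono) auto
    then show ?thesis using Q pow[of Q] by (simp add: field_simps)
  qed
  \<comment> \<open>The common stage fixes \<open>q powr (1 + i)\<close> up to a factor
    \<open>R\<close>.\<close>
  have Q'R: "Q' \<le> R * Q"
  proof (rule ccontr)
    assume "\<not> ?thesis"
    then have gt: "R * Q < Q'" by simp
    have "Q powr (- 1 - i) * \<kappa>' \<le> len n" using lens(2) unfolding Q_def by (simp add: mult.commute)
    also have "\<dots> < R * (\<kappa>' * Q' powr (- 1 - i))"
      unfolding len_Suc[of n] Q'_def using lens(3) R0 by (intro mult_strict_left_mono) auto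
    finally have "Q powr (- 1 - i) < R * Q' powr (- 1 - i)" using c_pos by (simp add: mult_ac)
    also have "\<dots> \<le> R * (R * Q) powr (- 1 - i)"
      using gt R0 Q i_bounds by (intro mult_left_mono powr_mono2') auto
    also have "\<dots> = R powr (- i) * Q powr (- 1 - i)"
      using R0 Q pow[of R] by (simp add: powr_mult)
    also have "\<dots> \<le> 1 * Q powr (- 1 - i)"
      using R0 i_bounds powr_mono[of "- i" 0 R] by (intro mult_right_mono) auto
    finally show False by simp
  qed
  have near1: "\<bar>Q * x - (p + \<gamma>)\<bar> \<le> c' * Q powr (- i)" "\<bar>Q * (a * x + b) - (r + \<delta>)\<bar> \<le> c' * Q powr (- j)"
    and near2: "\<bar>Q' * x' - (p' + \<gamma>)\<bar> \<le> c' * Q' powr (- i)" "\<bar>Q' * (a * x' + b) - (r' + \<delta>)\<bar> \<le> c' * Q' powr (- j)"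
    using near unfolding near_def Q_def Q'_def by auto
  have dec: "c' * Q' powr (- s) \<le> c' * Q powr (- s)" if "s \<ge> 0" for s
    using Q that c_pos by (intro mult_left_mono powr_mono2') auto
  have near2': "\<bar>Q' * x' - (p' + \<gamma>)\<bar> \<le> c' * Q powr (- i)" "\<bar>Q' * (a * x' + b) - (r' + \<delta>)\<bar> \<le> c' * Q powr (- j)"
    using order.trans[OF near2(1) dec] order.trans[OF near2(2) dec] ij by auto
  have Qx: "Q * \<bar>x - x'\<bar> \<le> R * \<kappa>' * Q powr (- i)"
    using mult_left_mono[OF dx, of Q] lenQ Q by linarith
  have "4 * R \<le> R * R" using R by (intro mult_right_mono) auto
  then have R1: "2 + R \<le> R ^ 2" using R unfolding power2_eq_square by linarith
  have diff_p: "\<bar>(Q' - Q) * x' - (p' - p)\<bar> \<le> c / R * Q powr (- i)"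
  proof -
    have "(Q' - Q) * x' - (p' - p) = (Q' * x' - (p' + \<gamma>)) - (Q * x - (p + \<gamma>)) + Q * (x - x')"
      by (simp add: algebra_simps)
    then have "\<bar>(Q' - Q) * x' - (p' - p)\<bar>
        \<le> \<bar>Q' * x' - (p' + \<gamma>)\<bar> + \<bar>Q * x - (p + \<gamma>)\<bar> + \<bar>Q * (x - x')\<bar>" by linarith
    also have "\<dots> \<le> c' * Q powr (- i) + c' * Q powr (- i) + R * \<kappa>' * Q powr (- i)"
      using near1 near2' Qx Q by (intro add_mono) (auto simp: abs_mult)
    also have "\<dots> = (2 * c' + R * \<kappa>') * Q powr (- i)" by (simp add: algebra_simps)
    also have "\<dots> \<le> ((2 + R) * \<kappa>') * Q powr (- i)"
      using cs(3) by (intro mult_right_mono) (auto simp: algebra_simps)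
    also have "\<dots> \<le> (R ^ 2 * \<kappa>' * (2 + \<bar>a\<bar>)) * Q powr (- i)"
    proof (intro mult_right_mono)
      have "(2 + R) * \<kappa>' * 1 \<le> R ^ 2 * \<kappa>' * (2 + \<bar>a\<bar>)"
        using R1 c_pos R0 by (intro mult_mono) auto
      then show "(2 + R) * \<kappa>' \<le> R ^ 2 * \<kappa>' * (2 + \<bar>a\<bar>)" by simp
    qed simp
    also have "R ^ 2 * \<kappa>' * (2 + \<bar>a\<bar>) = c / R"
      unfolding cs(1)[symmetric] using R0 by (simp add: power2_eq_square power3_eq_cube)
    finally show ?thesis .
  qed
  show ?thesis
  proof (cases "q' = q")
    case True
    have "Q powr (- i) \<le> 1" using Q i_bounds powr_mono[of "- i" 0 Q] by simp
    then have "c / R * Q powr (- i) \<le> (1/4) * 1"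
      using cs(6) c_pos R0 divide_left_mono[of 1 R c] by (intro mult_mono) auto
    moreover have "(Q' - Q) * x' - (p' - p) = - real_of_int (p' - p)"
      using True unfolding Q_def Q'_def by simp
    ultimately have "\<bar>real_of_int (p' - p)\<bar> < 1" using diff_p by linarith
    then have pp: "p' = p" by linarith
    have "Q * \<bar>x - x'\<bar> = \<bar>(Q * x - (p + \<gamma>)) - (Q * x' - (p + \<gamma>))\<bar>"
      using Q by (simp add: abs_mult flip: right_diff_distrib)
    also have "\<dots> \<le> 2 * c' * Q powr (- i)" using near1 near2 True pp unfolding Q_def Q'_def by simp
    finally have "\<bar>x - x'\<bar> \<le> 2 * c' * Q powr (- 1 - i)"
      unfolding pow[OF Q(2)] using Q by (simp add: field_simps)
    also have "\<dots> = \<kappa>' * Q powr (- 1 - i) / R ^ 7" unfolding c'_def by simp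
    also have "\<dots> \<le> len n / R ^ 7" using lens(2) R0 unfolding Q_def by (intro divide_right_mono) auto
    finally show ?thesis unfolding len_add .
  next
    case False
    define q0 where "q0 = q' - q"
    define Q0 where "Q0 = real_of_int q0"
    have q0: "1 \<le> q0" unfolding q0_def using q False by simp
    have Q0: "Q0 \<ge> 1" "Q0 > 0" "Q0 \<le> R * Q" "Q0 = Q' - Q"
      using q0 Q Q'R unfolding Q0_def q0_def Q_def Q'_def by auto
    have up: "Q powr (- s) \<le> R * Q0 powr (- s)" if "0 \<le> s" "s \<le> 1" for s
      using Q Q0 R0 that by (intro powr_minus_le_mult_powr) auto
    have near_p: "\<bar>Q0 * x' - (p' - p)\<bar> \<le> c * Q0 powr (- i)"
    proof -
      have "\<bar>Q0 * x' - (p' - p)\<bar> \<le> c / R * (R * Q0 powr (- i))"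
        unfolding Q0(4) using diff_p mult_left_mono[OF up[of i], of "c / R"] c_pos R0 i_bounds Q0(4) by simp
      then show ?thesis using R0 by simp
    qed
    have near_r: "\<bar>Q0 * (a * x' + b) - (r' - r)\<bar> \<le> c * Q0 powr (- j)"
    proof -
      have "Q0 * (a * x' + b) - (r' - r)
          = (Q' * (a * x' + b) - (r' + \<delta>)) - (Q * (a * x + b) - (r + \<delta>)) + a * (Q * (x - x'))"
        unfolding Q0(4) by (simp add: algebra_simps)
      then have "\<bar>Q0 * (a * x' + b) - (r' - r)\<bar>
          \<le> \<bar>Q' * (a * x' + b) - (r' + \<delta>)\<bar> + \<bar>Q * (a * x + b) - (r + \<delta>)\<bar> + \<bar>a * (Q * (x - x'))\<bar>"
        by linarith
      also have "\<dots> \<le> c' * Q powr (- j) + c' * Q powr (- j) + \<bar>a\<bar> * (R * \<kappa>' * Q powr (- j))"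
      proof (intro add_mono)
        show "\<bar>Q' * (a * x' + b) - (r' + \<delta>)\<bar> \<le> c' * Q powr (- j)"
          by (rule near2')
        have "Q powr (- i) \<le> Q powr (- j)" using Q ij by (intro powr_mono) auto
        then have "R * \<kappa>' * Q powr (- i) \<le> R * \<kappa>' * Q powr (- j)"
          using R0 c_pos by (intro mult_left_mono) auto
        then have "\<bar>a\<bar> * (Q * \<bar>x - x'\<bar>) \<le> \<bar>a\<bar> * (R * \<kappa>' * Q powr (- j))"
          using Qx by (intro mult_left_mono) auto
        then show "\<bar>a * (Q * (x - x'))\<bar> \<le> \<bar>a\<bar> * (R * \<kappa>' * Q powr (- j))"
          using Q by (simp add: abs_mult)
      qed (use near1 in simp)
      also have "\<dots> = (2 * c' + \<bar>a\<bar> * (R * \<kappa>')) * Q powr (- j)" by (simp add: algebra_simps)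
      also have "\<dots> \<le> (R ^ 2 * \<kappa>' * (2 + \<bar>a\<bar>)) * Q powr (- j)"
      proof (intro mult_right_mono)
        have "1 \<le> R ^ 2" "R \<le> R ^ 2" using R0 R1 by linarith+
        then have "c' * 2 \<le> \<kappa>' * R ^ 2 * 2" "\<bar>a\<bar> * (R * \<kappa>') \<le> \<bar>a\<bar> * (R ^ 2 * \<kappa>')"
          using cs(3) c_pos mult_mono[of c' \<kappa>' 1 "R ^ 2"] by (auto intro!: mult_left_mono mult_right_mono)
        then show "2 * c' + \<bar>a\<bar> * (R * \<kappa>') \<le> R ^ 2 * \<kappa>' * (2 + \<bar>a\<bar>)" by (simp add: algebra_simps)
      qed simp
      also have "R ^ 2 * \<kappa>' * (2 + \<bar>a\<bar>) = c / R"
        unfolding cs(1)[symmetric] using R0 by (simp add: power2_eq_square power3_eq_cube)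
      also have "c / R * Q powr (- j) \<le> c / R * (R * Q0 powr (- j))"
        using up[of j] ij i_bounds c_pos R0 by (intro mult_left_mono) auto
      finally show ?thesis using R0 by simp
    qed
    have near0: "near c q0 (of_int (p' - p)) (of_int (r' - r)) x'"
      using near_p near_r unfolding near_def Q0_def by simp
    \<comment> \<open>One factor \<open>R\<close> is lost through the stage and two through
      \<open>Q0 \<le> R * Q\<close>; this is the \<open>R ^ 3\<close> in
      \<open>\<kappa>'\<close>.\<close>
    have "len n \<le> c1 * Q0 powr (- 1 - i)"
    proof -
      have "len n \<le> R * (\<kappa>' * Q powr (- 1 - i))"
        unfolding len_Suc[of n] Q_def using lens(1) R0 by (intro mult_left_mono) auto
      also have "Q powr (- 1 - i) \<le> R ^ 2 * Q0 powr (- 1 - i)"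
      proof -
        have "1 / Q \<le> R / Q0" using Q Q0 by (simp add: field_simps)
        then have "Q powr (- i) * (1 / Q) \<le> R * Q0 powr (- i) * (R / Q0)"
          using up[of i] i_bounds Q Q0 R0 by (intro mult_mono) auto
        then show ?thesis unfolding pow[OF Q(2)] pow[OF Q0(2)] by (simp add: power2_eq_square mult_ac)
      qed
      also have "R * (\<kappa>' * (R ^ 2 * Q0 powr (- 1 - i))) = \<kappa>' * R ^ 3 * 1 * Q0 powr (- 1 - i)"
        by (simp add: power2_eq_square power3_eq_cube)
      also have "\<dots> \<le> \<kappa>' * R ^ 3 * (2 + \<bar>a\<bar>) * Q0 powr (- 1 - i)"
        using c_pos R0 by (intro mult_right_mono mult_left_mono) auto
      also have "\<kappa>' * R ^ 3 * (2 + \<bar>a\<bar>) = c" using cs(1) by (simp add: mult_ac)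
      also have "c * Q0 powr (- 1 - i) \<le> c1 * Q0 powr (- 1 - i)"
        using c_pos unfolding c_def by (intro mult_right_mono) auto
      finally show ?thesis using c_pos R0 by (simp add: mult_left_mono)
    qed
    then show ?thesis
      using no_near_point[OF J x(2) dead q0 near0] unfolding Q0_def by simp
  qed
qed

lemma isolating_danger: "isolating u0 l (1/R) danger"
  unfolding isolating_def len_def[symmetric]
proof (intro allI impI ballI)
  fix n m v x x'
  assume J: "{v..v + len n} \<subseteq> {u0..u0 + l}"
    and "\<forall>k m'. k + 7 + m' \<le> n \<longrightarrow> danger k m' \<inter> {v..v + len n} = {}"
    and x: "x \<in> danger n m \<inter> {v..v + len n}" "x' \<in> danger n m \<inter> {v..v + len n}"
  then have dead: "\<And>k m. k + 7 + m \<le> n \<Longrightarrow> danger k m \<inter> {v..v + len n} = {}" by blast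
  have xJ: "x \<in> {v..v + len n}" "x' \<in> {v..v + len n}" and d: "\<bar>x - x'\<bar> \<le> len n" using x by auto
  show "\<bar>x - x'\<bar> \<le> len (n + 7 + m)"
  proof (cases m)
    case 0
    obtain q p r where q: "1 \<le> q" "near c' q (of_int p + \<gamma>) (of_int r + \<delta>) x"
      "len (Suc n) < \<kappa>' * q powr (- 1 - i)" "\<kappa>' * q powr (- 1 - i) \<le> len n"
      using x(1) 0 unfolding danger_def by auto
    obtain q' p' r' where q': "1 \<le> q'" "near c' q' (of_int p' + \<gamma>) (of_int r' + \<delta>) x'"
      "len (Suc n) < \<kappa>' * q' powr (- 1 - i)" "\<kappa>' * q' powr (- 1 - i) \<le> len n"
      using x(2) 0 unfolding danger_def by auto
    have "\<bar>x - x'\<bar> \<le> len (n + 7)"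
    proof (cases "q \<le> q'")
      case True
      show ?thesis by (rule close_of_shifted[OF q(1) True q(2) q'(2) q(3,4) q'(3,4) J xJ dead])
    next
      case False
      then have "q' \<le> q" by simp
      from close_of_shifted[OF q'(1) this q'(2) q(2) q'(3,4) q(3,4) J xJ(2,1) dead]
      show ?thesis by (simp add: abs_minus_commute)
    qed
    then show ?thesis using 0 by simp
  next
    case (Suc t)
    obtain q p r A B C where h: "hit n t x q p r A B C"
      using x(1) Suc unfolding danger_def by auto
    obtain q' p' r' A' B' C' where h': "hit n t x' q' p' r' A' B' C'"
      using x(2) Suc unfolding danger_def by auto
    have "\<bar>x - x'\<bar> \<le> len (n + 8 + t)"
    proof (cases "t \<le> t0")
      case True
      then show ?thesis by (rule close_of_low_class[OF h h' d])
    next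
      case False
      then show ?thesis by (intro close_of_high_class[OF h h' J xJ dead]) auto
    qed
    then show ?thesis using Suc by (simp add: add_ac)
  qed
qed

text \<open>Since \<open>\<kappa>' \<le> l\<close>, every height has a stage, so class 0 accounts
  for all inhomogeneous points.\<close>

lemma safe_imp_not_near:
  assumes "\<And>k m. x \<notin> danger k m" "1 \<le> q"
  shows "\<not> near c' q (of_int p + \<gamma>) (of_int r + \<delta>) x"
proof
  assume near: "near c' q (of_int p + \<gamma>) (of_int r + \<delta>) x"
  have "real_of_int q powr (- 1 - i) \<le> q powr 0" using assms(2) i_bounds by (intro powr_mono) auto
  then have "\<kappa>' * q powr (- 1 - i) \<le> \<kappa>' * 1"
    using assms(2) c_pos by (intro mult_left_mono) auto
  then have "\<kappa>' * q powr (- 1 - i) \<le> l" using shift_constants by linarith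
  moreover have "0 < \<kappa>' * q powr (- 1 - i)" using assms(2) c_pos by simp
  ultimately obtain n where "len (Suc n) < \<kappa>' * q powr (- 1 - i)" "\<kappa>' * q powr (- 1 - i) \<le> len n"
    using geometric_level_exists[OF _ _ R0(3)] unfolding len_def by blast
  then have "x \<in> danger n 0" unfolding danger_def using near assms(2) by auto
  then show False using assms(1) by blast
qed

end

section \<open>The winning property\<close>

text \<open>All constants may depend on \<beta> and on the first ball, as the constant in
  \<open>Bad\<close> may depend on the point. They are chosen in the order \<open>R\<close>,
  \<open>X\<close>, \<open>\<kappa>0\<close> and \<open>c0\<close>, \<open>g\<close>,
  \<open>\<kappa>\<close>, \<open>t0\<close>.\<close>

lemma isolating_family_exists:
  fixes i j a b \<epsilon> \<gamma> \<delta> \<beta> u l :: real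
  assumes ij: "0 < j" "j \<le> i" "i + j = 1" and T: "transversal i j a b \<epsilon>" "\<epsilon> > 0"
    and \<beta>: "0 < \<beta>" "\<beta> < 1" and l: "l > 0"
  shows "\<exists>E. isolating u l (\<beta>/4) E \<and> (\<forall>x::real. (\<forall>k m. x \<notin> E k m) \<longrightarrow>
     (\<exists>c>0. \<forall>(q::int) (p::int) (r::int). (1::int) \<le> q \<longrightarrow> c * q powr (- i) < \<bar>q * x - (p + \<gamma>)\<bar> \<or>
        c * q powr (- j) < \<bar>q * (a * x + b) - (r + \<delta>)\<bar>))"
proof -
  define R where "R = 4 / \<beta>"
  have R: "R \<ge> 4" and R\<beta>: "\<beta>/4 = 1/R" unfolding R_def using \<beta> by (auto simp: field_simps)
  define X where "X = \<bar>u\<bar> + l"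
  have "X > 0" unfolding X_def using l by simp
  then obtain \<kappa>1 c0 where k: "\<kappa>1 > 0" "c0 > 0"
    and T1: "\<And>(q::int) (A::int) (B::int) (C::int) (x::real).
     (1::int) \<le> q \<Longrightarrow> (A, B) \<noteq> (0, 0) \<Longrightarrow> \<bar>real_of_int A\<bar> \<le> q powr i \<Longrightarrow> \<bar>real_of_int B\<bar> \<le> q powr j \<Longrightarrow>
     \<bar>x\<bar> \<le> X \<Longrightarrow> \<bar>of_int A * x + of_int B * (a * x + b) + of_int C\<bar> \<le> c0 / q \<Longrightarrow>
     \<kappa>1 * q powr (\<epsilon> - 1) \<le> \<bar>of_int A + a * of_int B\<bar>"
    using T(1) unfolding transversal_def by blast
  define \<kappa>0 where "\<kappa>0 = min 1 \<kappa>1"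
  have \<kappa>0: "0 < \<kappa>0" "\<kappa>0 \<le> 1" unfolding \<kappa>0_def using k by auto
  define g where "g = nat \<lceil>max (2/\<epsilon>) (3/j)\<rceil>"
  have "real g \<ge> max (2/\<epsilon>) (3/j)" unfolding g_def by linarith
  then have g: "2 \<le> real g * \<epsilon>" "3 \<le> real g * j"
    using T(2) ij by (auto simp: pos_divide_le_eq)
  define \<kappa> where "\<kappa> = min (min (l * \<kappa>0\<^sup>2 / (1 + \<bar>a\<bar>)) (\<kappa>0 / (8 * R\<^sup>2 * R ^ g * (1 + \<bar>a\<bar>)))) c0"
  have "0 < 8 * R\<^sup>2 * R ^ g * (1 + \<bar>a\<bar>)" using R by (intro mult_pos_pos) auto
  moreover have "\<kappa> \<le> \<kappa>0 / (8 * R\<^sup>2 * R ^ g * (1 + \<bar>a\<bar>))" unfolding \<kappa>_def by simp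
  ultimately have \<kappa>2: "\<kappa> * (8 * R\<^sup>2 * R ^ g * (1 + \<bar>a\<bar>)) \<le> \<kappa>0" by (simp only: pos_le_divide_eq)
  have "\<kappa> \<le> l * \<kappa>0\<^sup>2 / (1 + \<bar>a\<bar>)" unfolding \<kappa>_def by simp
  then have \<kappa>3: "\<kappa> * (1 + \<bar>a\<bar>) \<le> l * \<kappa>0\<^sup>2" by (simp add: pos_le_divide_eq add_pos_nonneg)
  have \<kappa>: "0 < \<kappa>" "\<kappa> \<le> c0"
    unfolding \<kappa>_def using l \<kappa>0 k R by (auto intro!: divide_pos_pos mult_pos_pos add_pos_nonneg)
  obtain t0 where "(1 + \<bar>a\<bar>) ^ 4 * 64 * R ^ (12 + 3 * g) < R ^ t0"
    using real_arch_pow[of R] R by auto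
  then have t0: "(1 + \<bar>a\<bar>) ^ 4 * 64 * R ^ (12 + 3 * g) \<le> R ^ t0" by simp
  interpret dangerous_sets i j a b \<gamma> \<delta> u l R X \<kappa>0 c0 \<epsilon> \<kappa> g t0
  proof
    show "{u..u + l} \<subseteq> {- X..X}" unfolding X_def by auto
    show "\<kappa>0 * q powr (\<epsilon> - 1) \<le> \<bar>of_int A + a * of_int B\<bar>"
      if "(1::int) \<le> q" "(A, B) \<noteq> (0, 0)" "\<bar>real_of_int A\<bar> \<le> q powr i" "\<bar>real_of_int B\<bar> \<le> q powr j"
        "\<bar>x\<bar> \<le> X" "\<bar>of_int A * x + of_int B * (a * x + b) + of_int C\<bar> \<le> c0 / q"
      for q A B C :: int and x :: real
    proof -
      have "\<kappa>0 * q powr (\<epsilon> - 1) \<le> \<kappa>1 * q powr (\<epsilon> - 1)"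
        unfolding \<kappa>0_def by (intro mult_right_mono) auto
      also have "\<dots> \<le> \<bar>of_int A + a * of_int B\<bar>" by (rule T1[OF that])
      finally show ?thesis .
    qed
  qed (use ij l R \<kappa>0 k T g \<kappa> \<kappa>2 \<kappa>3 t0 in blast)+
  have "\<exists>c>0. \<forall>(q::int) (p::int) (r::int). (1::int) \<le> q \<longrightarrow> c * q powr (- i) < \<bar>q * x - (p + \<gamma>)\<bar> \<or>
        c * q powr (- j) < \<bar>q * (a * x + b) - (r + \<delta>)\<bar>" if "\<forall>k m. x \<notin> danger k m" for x :: real
  proof (intro exI[of _ c'] conjI allI impI)
    show "0 < c'" by (rule c_pos)
    show "c' * q powr (- i) < \<bar>q * x - (p + \<gamma>)\<bar> \<or> c' * q powr (- j) < \<bar>q * (a * x + b) - (r + \<delta>)\<bar>"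
      if "(1::int) \<le> q" for q p r :: int
      using safe_imp_not_near[OF _ that, of x p r] \<open>\<forall>k m. x \<notin> danger k m\<close>
      unfolding near_def by (auto simp: not_le)
  qed
  then show ?thesis using isolating_danger unfolding R\<beta> by blast
qed

text \<open>Raising \<open>c * q powr (- s) < d\<close> to the power \<open>1 / s\<close> gives
  \<open>c powr (1/s) / q < d powr (1/s)\<close>; \<open>p\<close> and \<open>r\<close> are taken to
  be nearest integers.\<close>

lemma BadI:
  fixes x y \<gamma> \<delta> i j c :: real
  assumes ij: "0 < i" "0 < j" and c: "c > 0"
    and far: "\<And>(q::int) (p::int) (r::int). (1::int) \<le> q \<Longrightarrow> c * q powr (- i) < \<bar>q * x - (p + \<gamma>)\<bar> \<or>
        c * q powr (- j) < \<bar>q * y - (r + \<delta>)\<bar>"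
  shows "(x, y) \<in> Bad (\<gamma>, \<delta>) i j"
proof -
  define c2 where "c2 = min (c powr (1/i)) (c powr (1/j))"
  have root: "c powr (1/s) / q < d powr (1/s)" if "0 < s" "1 \<le> q" "c * real q powr (- s) < d" for s d and q :: nat
  proof -
    have "(c * real q powr (- s)) powr (1/s) < d powr (1/s)"
      using that c by (intro powr_less_mono2) auto
    moreover have "(c * real q powr (- s)) powr (1/s) = c powr (1/s) / q"
      using that c by (simp add: powr_divide powr_powr powr_minus_divide)
    ultimately show ?thesis by simp
  qed
  have "c2 / q < max (dist_int (real q * x - \<gamma>) powr (1/i)) (dist_int (real q * y - \<delta>) powr (1/j))"
    if q: "q \<ge> 1" for q :: nat
  proof -
    obtain p where p: "dist_int (real q * x - \<gamma>) = \<bar>real q * x - \<gamma> - of_int p\<bar>" by (rule dist_int_attained)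
    obtain r where r: "dist_int (real q * y - \<delta>) = \<bar>real q * y - \<delta> - of_int r\<bar>" by (rule dist_int_attained)
    have "c * real q powr (- i) < dist_int (real q * x - \<gamma>) \<or>
          c * real q powr (- j) < dist_int (real q * y - \<delta>)"
      using far[of "int q" p r] q unfolding p r by (simp add: algebra_simps)
    moreover have "c2 / q \<le> c powr (1/i) / q" "c2 / q \<le> c powr (1/j) / q"
      unfolding c2_def by (auto intro!: divide_right_mono)
    ultimately show ?thesis using root[OF ij(1) q] root[OF ij(2) q] by (auto simp: less_max_iff_disj dest: le_less_trans)
  qed
  moreover have "c2 > 0" unfolding c2_def using c by simp
  ultimately show ?thesis unfolding Bad_def by auto
qed

text \<open>The parameter has to be the coordinate with the larger exponent. For
  \<open>i < j\<close> the line is therefore parametrised by \<open>y\<close>, with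
  \<open>1/a\<close> and \<open>- b/a\<close> in place of \<open>a\<close> and
  \<open>b\<close>.\<close>

lemma winning_of_transversal:
  fixes i j a b \<epsilon> :: real
  assumes ij: "0 < i" "0 < j" "i + j = 1" and a: "a \<noteq> 0" and T: "transversal i j a b \<epsilon>" "\<epsilon> > 0"
  shows "winning (plane_line a b) (Bad \<theta> i j \<inter> plane_line a b)"
proof -
  obtain \<gamma> \<delta> where \<theta>: "\<theta> = (\<gamma>, \<delta>)" by (cases \<theta>)
  have "alpha_winning (plane_line a b) (1/4) (Bad \<theta> i j \<inter> plane_line a b)"
  proof (cases "j \<le> i")
    case True
    have line: "plane_line a b = range (\<lambda>t. (0, b) + t *\<^sub>R (1, a))"
      unfolding plane_line_def by auto
    show ?thesis
      unfolding line
    proof (rule alpha_winning_quarterI)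
      fix \<beta> u l :: real assume "0 < \<beta>" "\<beta> < 1" "l > 0"
      then obtain E where E: "isolating u l (\<beta>/4) E" and safe: "\<And>x::real. \<forall>k m. x \<notin> E k m \<Longrightarrow>
         \<exists>c>0. \<forall>(q::int) (p::int) (r::int). (1::int) \<le> q \<longrightarrow> c * q powr (- i) < \<bar>q * x - (p + \<gamma>)\<bar> \<or>
            c * q powr (- j) < \<bar>q * (a * x + b) - (r + \<delta>)\<bar>"
        using isolating_family_exists[OF ij(2) True ij(3) T, of \<beta> l u \<gamma> \<delta>] by blast
      have "(0, b) + x *\<^sub>R (1, a) \<in> Bad \<theta> i j \<inter> range (\<lambda>t. (0, b) + t *\<^sub>R (1, a))"
        if "\<forall>k m. x \<notin> E k m" for x
      proof -
        have "(x, a * x + b) \<in> Bad (\<gamma>, \<delta>) i j" using safe[OF that] BadI[OF ij(1,2)] by blast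
        moreover have "(0, b) + x *\<^sub>R (1, a) = (x, a * x + b)" by simp
        ultimately show ?thesis unfolding \<theta> by (metis IntI rangeI)
      qed
      then show "\<exists>E. isolating u l (\<beta>/4) E \<and> (\<forall>x\<in>{u..u + l}. (\<forall>k m. x \<notin> E k m) \<longrightarrow>
          (0, b) + x *\<^sub>R (1, a) \<in> Bad \<theta> i j \<inter> range (\<lambda>t. (0, b) + t *\<^sub>R (1, a)))"
        using E by blast
    qed (simp add: zero_prod_def)
  next
    case False
    have line: "plane_line a b = range (\<lambda>t. (- b/a, 0) + t *\<^sub>R (1/a, 1))"
    proof -
      have "(x, a * x + b) = (- b/a, 0) + (a * x + b) *\<^sub>R (1/a, 1)" for x
        using a by (simp add: field_simps)
      then show ?thesis unfolding plane_line_def using a by (auto simp: field_simps image_iff)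
    qed
    show ?thesis
      unfolding line
    proof (rule alpha_winning_quarterI)
      fix \<beta> u l :: real assume "0 < \<beta>" "\<beta> < 1" "l > 0"
      moreover have "i \<le> j" "j + i = 1" using False ij by auto
      ultimately obtain E where E: "isolating u l (\<beta>/4) E" and safe: "\<And>y::real. \<forall>k m. y \<notin> E k m \<Longrightarrow>
         \<exists>c>0. \<forall>(q::int) (p::int) (r::int). (1::int) \<le> q \<longrightarrow> c * q powr (- j) < \<bar>q * y - (p + \<delta>)\<bar> \<or>
            c * q powr (- i) < \<bar>q * (1/a * y + - b/a) - (r + \<gamma>)\<bar>"
        using isolating_family_exists[OF ij(1) _ _ transversal_swap[OF a T(1)] T(2), of \<beta> l u \<delta> \<gamma>] by blast
      have "(- b/a, 0) + y *\<^sub>R (1/a, 1) \<in> Bad \<theta> i j \<inter> range (\<lambda>t. (- b/a, 0) + t *\<^sub>R (1/a, 1))"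
        if "\<forall>k m. y \<notin> E k m" for y
      proof -
        have "(1/a * y + - b/a, y) \<in> Bad (\<gamma>, \<delta>) i j" using safe[OF that] BadI[OF ij(1,2)] by blast
        moreover have "(- b/a, 0) + y *\<^sub>R (1/a, 1) = (1/a * y + - b/a, y)" by simp
        ultimately show ?thesis unfolding \<theta> by (metis IntI rangeI)
      qed
      then show "\<exists>E. isolating u l (\<beta>/4) E \<and> (\<forall>x\<in>{u..u + l}. (\<forall>k m. x \<notin> E k m) \<longrightarrow>
          (- b/a, 0) + x *\<^sub>R (1/a, 1) \<in> Bad \<theta> i j \<inter> range (\<lambda>t. (- b/a, 0) + t *\<^sub>R (1/a, 1)))"
        using E by blast
    qed (simp add: zero_prod_def)
  qed
  then show ?thesis unfolding winning_def by (intro conjI exI[of _ "1/4"]) auto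
qed

theorem theorem2:
  fixes i j \<sigma> a b :: real
  assumes "0 < i" "i < 1" "0 < j" "j < 1" "i + j = 1"
    and "\<sigma> = min i j"
    and "a \<noteq> 0"
  shows "((\<exists>\<epsilon>>0. liminf (\<lambda>q::nat. ereal (real q powr (1 / \<sigma> - \<epsilon>) *
              max (dist_int (real q * a)) (dist_int (real q * b)))) > 0) \<longrightarrow>
            (\<forall>\<theta>. winning (plane_line a b) (Bad \<theta> i j \<inter> plane_line a b))) \<and>
         (a \<in> \<rat> \<longrightarrow>
            liminf (\<lambda>q::nat. ereal (real q powr (1 / \<sigma>) *
              max (dist_int (real q * a)) (dist_int (real q * b)))) > 0 \<longrightarrow>
            (\<forall>\<theta>. winning (plane_line a b) (Bad \<theta> i j \<inter> plane_line a b)))"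
proof (intro conjI impI allI)
  note ij = assms(1,3,5)
  have \<sigma>: "\<sigma> > 0" using assms by (simp add: min_def)
  fix \<theta> :: "real \<times> real"
  {
    assume "\<exists>\<epsilon>>0. liminf (\<lambda>q::nat. ereal (real q powr (1 / \<sigma> - \<epsilon>) *
              max (dist_int (real q * a)) (dist_int (real q * b)))) > 0"
    then obtain \<epsilon> where \<epsilon>: "\<epsilon> > 0" and L: "liminf (\<lambda>q::nat. ereal (real q powr (1 / \<sigma> - \<epsilon>) *
              max (dist_int (real q * a)) (dist_int (real q * b)))) > 0" by blast
    \<comment> \<open>The transversality estimate is stated for \<epsilon> at most 1; decreasing
      \<epsilon> only increases the power of \<open>n\<close>, so the bound persists.\<close>
    define \<epsilon>1 where "\<epsilon>1 = min \<epsilon> 1"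
    have \<epsilon>1: "0 < \<epsilon>1" "\<epsilon>1 \<le> 1" "\<epsilon>1 \<le> \<epsilon>" unfolding \<epsilon>1_def using \<epsilon> by auto
    obtain \<kappa> where \<kappa>: "\<kappa> > 0" "\<And>n::nat. n \<ge> 1 \<Longrightarrow>
        \<kappa> \<le> real n powr (1/\<sigma> - \<epsilon>) * max (dist_int (real n * a)) (dist_int (real n * b))"
      using liminf_pos_imp_uniform_bound[OF L] by blast
    have "\<kappa> \<le> real n powr (1/\<sigma> - \<epsilon>1) * max (dist_int (real n * a)) (dist_int (real n * b))"
      if "n \<ge> 1" for n :: nat
    proof -
      note \<kappa>(2)[OF that]
      also have "real n powr (1/\<sigma> - \<epsilon>) * max (dist_int (real n * a)) (dist_int (real n * b))
          \<le> real n powr (1/\<sigma> - \<epsilon>1) * max (dist_int (real n * a)) (dist_int (real n * b))"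
        using that \<epsilon>1 dist_int_nonneg[of "real n * a"]
        by (intro mult_right_mono powr_mono) (auto simp: le_max_iff_disj)
      finally show ?thesis .
    qed
    then have "transversal i j a b (\<epsilon>1 * \<sigma>)"
      using \<epsilon>1 \<kappa>(1) by (intro transversal_of_uniform_bound[OF ij assms(6,7), where \<kappa> = \<kappa>]) auto
    then show "winning (plane_line a b) (Bad \<theta> i j \<inter> plane_line a b)"
      using \<epsilon>1 \<sigma> by (intro winning_of_transversal[OF ij assms(7), where \<epsilon> = "\<epsilon>1 * \<sigma>"]) auto
  }
  {
    assume a: "a \<in> \<rat>" and L: "liminf (\<lambda>q::nat. ereal (real q powr (1 / \<sigma>) *
              max (dist_int (real q * a)) (dist_int (real q * b)))) > 0"
    obtain \<kappa> where \<kappa>: "\<kappa> > 0" "\<And>n::nat. n \<ge> 1 \<Longrightarrow>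
        \<kappa> \<le> real n powr (1/\<sigma>) * max (dist_int (real n * a)) (dist_int (real n * b))"
      using liminf_pos_imp_uniform_bound[OF L] by blast
    \<comment> \<open>Exponent 0 is too weak for the strategy, but rationality of \<open>a\<close>
      raises it to 1.\<close>
    have "transversal i j a b (0 * \<sigma>)"
      using \<kappa> by (intro transversal_of_uniform_bound[OF ij assms(6,7), where \<kappa> = \<kappa>]) auto
    then have "transversal i j a b 1" using transversal_rational[OF a] by simp
    then show "winning (plane_line a b) (Bad \<theta> i j \<inter> plane_line a b)"
      by (intro winning_of_transversal[OF ij assms(7)]) auto
  }
qed

end
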